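(* Let $n\in\{0,1,2\}$, $\gamma>1$, $\gamma_*=\frac{n+3}{n+1}$, and let $S\equiv A_0>0$ be constant. Consider the Lagrangian $$L=\tfrac12\varphi_t^2-\frac{S}{\gamma-1}\varphi^{n(1-\gamma)}\varphi_s^{1-\gamma}$$ and its Euler–Lagrange equation $(\ast)$ for $\varphi(t,s)$. In addition to the Noether symmetries valid for arbitrary entropy (listed in the context), the following vector fields are variational symmetries of $L$: $$Z_2=\partial_s,\qquad Z_3=((n+3)\gamma-n-1)\,t\partial_t+((n+1)\gamma-n-3)\,s\partial_s+(\gamma+1)\varphi\partial_\varphi .$$ They give the conservation laws $D_tT^t+D_sT^s=0$ on solutions of $(\ast)$ with densities $$T_2^t=-\varphi_s\varphi_t,\qquad T_2^s=\frac{\varphi_t^2}{2}-\frac{\gamma S}{\gamma-1}\varphi^{n(1-\gamma)}\varphi_s^{1-\gamma};$$ $$T_3^t=-((n+3)\gamma-n-1)\,t\Big(\frac{\varphi_t^2}{2}+\frac{S}{\gamma-1}\varphi^{n(1-\gamma)}\varphi_s^{1-\gamma}\Big)-((n+1)\gamma-n-3)\,s\,\varphi_s\varphi_t+(\gamma+1)\varphi\varphi_t,$$ $$T_3^s=-((n+3)\gamma-n-1)\,tS\varphi^{n(1-\gamma)}\varphi_t\varphi_s^{-\gamma}+((n+1)\gamma-n-3)\,s\Big(\frac{\varphi_t^2}{2}-\frac{\gamma S}{\gamma-1}\varphi^{n(1-\gamma)}\varphi_s^{1-\gamma}\Big)+(\gamma+1)S\varphi^{-n\gamma+n+1}\varphi_s^{-\gamma}.$$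 The Noether symmetries among the point symmetries of $(\ast)$ are spanned by $Z_2$, $Z_3$ and those valid for arbitrary entropy for the given $n,\gamma$; when $\gamma=\gamma_*$, $Z_3$ is proportional to $2t\partial_t+\varphi\partial_\varphi$, so only $Z_2$ is new.
   Context: Equation $(\ast)$ is explicitly $\varphi_{tt}+\varphi^{n(1-\gamma)}\varphi_s^{-\gamma}\big(S'-n\gamma S\frac{\varphi_s}{\varphi}-\gamma S\frac{\varphi_{ss}}{\varphi_s}\big)=0$ (here $S'=0$), with $\varphi_s>0$ and $\varphi>0$ when $n\ge1$; it describes one-dimensional isentropic flows of a polytropic gas in mass Lagrangian coordinates. $D_t,D_s$ are total derivatives. A point vector field $X=\xi^t\partial_t+\xi^s\partial_s+\eta^\varphi\partial_\varphi$ with coefficients depending on $(t,s,\varphi)$, prolonged to first derivatives, is a Noether symmetry of $L$ if $XL+L(D_t\xi^t+D_s\xi^s)=D_tB_1+D_sB_2$ for some functions $B_1,B_2$ of $(t,s,\varphi)$; it is variational if $B_1=B_2=0$ can be taken. The Noether symmetries valid for arbitrary entropy $S(s)$ are: $\partial_t$ for all $n,\gamma$; additionally $\partial_\varphi$ and $t\partial_\varphi$ if $n=0$; additionally $2t\partial_t+\varphi\partial_\varphi$ and $t^2\partial_t+t\varphi\partial_\varphi$ if $\gamma=\gamma_*$. *)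

theory Defs
  imports "HOL-Analysis.Analysis"
begin

(* Jet coordinates.  With u = phi, p = phi_t, q = phi_s, r = phi_tt, m = phi_ts, w = phi_ss:
     jet0 = (t, s, u),  jet1 = (t, s, u, p, q),  jet2 = (t, s, u, p, q, r, m, w). *)

type_synonym jet0 = "real \<times> real \<times> real"
type_synonym jet1 = "real \<times> real \<times> real \<times> real \<times> real"
type_synonym jet2 = "real \<times> real \<times> real \<times> real \<times> real \<times> real \<times> real \<times> real"

(* A point vector field xi_t d_t + xi_s d_s + eta d_phi is its triple of coefficients. *)
type_synonym pvf = "jet0 \<Rightarrow> real \<times> real \<times> real"

(* Only used for open D. *)
primrec Ck_on ::
  "nat \<Rightarrow> 'a::euclidean_space set \<Rightarrow> ('a \<Rightarrow> 'b::real_normed_vector) \<Rightarrow> bool" where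
  "Ck_on 0 D f = continuous_on D f"
| "Ck_on (Suc k) D f =
     ((\<forall>x\<in>D. f differentiable (at x)) \<and> (\<forall>v. Ck_on k D (\<lambda>x. frechet_derivative f (at x) v)))"

definition smooth_on ::
  "'a::euclidean_space set \<Rightarrow> ('a \<Rightarrow> 'b::real_normed_vector) \<Rightarrow> bool" where
  "smooth_on D f \<longleftrightarrow> (\<forall>k. Ck_on k D f)"

(* The admissible values: phi_s > 0, and phi > 0 when n >= 1. *)

definition base_domain :: "nat \<Rightarrow> jet0 set" where
  "base_domain n = {(t, s, u). n \<ge> 1 \<longrightarrow> u > 0}"

definition jets1 :: "jet0 set \<Rightarrow> jet1 set" where
  "jets1 \<Omega> = {(t, s, u, p, q). (t, s, u) \<in> \<Omega> \<and> q > 0}"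

definition jets2 :: "jet0 set \<Rightarrow> jet2 set" where
  "jets2 \<Omega> = {(t, s, u, p, q, r, m, w). (t, s, u) \<in> \<Omega> \<and> q > 0}"

(* Total derivatives: D_t = d_t + phi_t d_phi + phi_tt d_{phi_t} + phi_ts d_{phi_s} + ..., and
   similarly D_s.  The suffix is the order of the jet space on which the argument lives; the
   result lives one order higher.  A sum of partial derivatives is written as the derivative
   in the corresponding direction. *)

definition Dt0 :: "(jet0 \<Rightarrow> real) \<Rightarrow> jet1 \<Rightarrow> real" where
  "Dt0 f = (\<lambda>(t, s, u, p, q). frechet_derivative f (at (t, s, u)) (1, 0, p))"

definition Ds0 :: "(jet0 \<Rightarrow> real) \<Rightarrow> jet1 \<Rightarrow> real" where
  "Ds0 f = (\<lambda>(t, s, u, p, q). frechet_derivative f (at (t, s, u)) (0, 1, q))"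

definition Dt1 :: "(jet1 \<Rightarrow> real) \<Rightarrow> jet2 \<Rightarrow> real" where
  "Dt1 f = (\<lambda>(t, s, u, p, q, r, m, w). frechet_derivative f (at (t, s, u, p, q)) (1, 0, p, r, m))"

definition Ds1 :: "(jet1 \<Rightarrow> real) \<Rightarrow> jet2 \<Rightarrow> real" where
  "Ds1 f = (\<lambda>(t, s, u, p, q, r, m, w). frechet_derivative f (at (t, s, u, p, q)) (0, 1, q, m, w))"

definition xi_t :: "pvf \<Rightarrow> jet0 \<Rightarrow> real" where "xi_t X = (\<lambda>x. fst (X x))"
definition xi_s :: "pvf \<Rightarrow> jet0 \<Rightarrow> real" where "xi_s X = (\<lambda>x. fst (snd (X x)))"
definition eta :: "pvf \<Rightarrow> jet0 \<Rightarrow> real" where "eta X = (\<lambda>x. snd (snd (X x)))"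

(* Coefficients of the prolonged field at d_{phi_t}, d_{phi_s}, d_{phi_tt}, d_{phi_ts}, d_{phi_ss}. *)

definition zeta_t :: "pvf \<Rightarrow> jet1 \<Rightarrow> real" where
  "zeta_t X = (\<lambda>(t, s, u, p, q). let z = (t, s, u, p, q) in
     Dt0 (eta X) z - p * Dt0 (xi_t X) z - q * Dt0 (xi_s X) z)"

definition zeta_s :: "pvf \<Rightarrow> jet1 \<Rightarrow> real" where
  "zeta_s X = (\<lambda>(t, s, u, p, q). let z = (t, s, u, p, q) in
     Ds0 (eta X) z - p * Ds0 (xi_t X) z - q * Ds0 (xi_s X) z)"

definition zeta_tt :: "pvf \<Rightarrow> jet2 \<Rightarrow> real" where
  "zeta_tt X = (\<lambda>(t, s, u, p, q, r, m, w).
     Dt1 (zeta_t X) (t, s, u, p, q, r, m, w)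
       - r * Dt0 (xi_t X) (t, s, u, p, q) - m * Dt0 (xi_s X) (t, s, u, p, q))"

definition zeta_ts :: "pvf \<Rightarrow> jet2 \<Rightarrow> real" where
  "zeta_ts X = (\<lambda>(t, s, u, p, q, r, m, w).
     Ds1 (zeta_t X) (t, s, u, p, q, r, m, w)
       - r * Ds0 (xi_t X) (t, s, u, p, q) - m * Ds0 (xi_s X) (t, s, u, p, q))"

definition zeta_ss :: "pvf \<Rightarrow> jet2 \<Rightarrow> real" where
  "zeta_ss X = (\<lambda>(t, s, u, p, q, r, m, w).
     Ds1 (zeta_s X) (t, s, u, p, q, r, m, w)
       - m * Ds0 (xi_t X) (t, s, u, p, q) - w * Ds0 (xi_s X) (t, s, u, p, q))"

definition prolong1 :: "pvf \<Rightarrow> jet1 \<Rightarrow> jet1" where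
  "prolong1 X = (\<lambda>(t, s, u, p, q).
     (xi_t X (t, s, u), xi_s X (t, s, u), eta X (t, s, u),
      zeta_t X (t, s, u, p, q), zeta_s X (t, s, u, p, q)))"

definition prolong2 :: "pvf \<Rightarrow> jet2 \<Rightarrow> jet2" where
  "prolong2 X = (\<lambda>(t, s, u, p, q, r, m, w). let z = (t, s, u, p, q, r, m, w) in
     (xi_t X (t, s, u), xi_s X (t, s, u), eta X (t, s, u),
      zeta_t X (t, s, u, p, q), zeta_s X (t, s, u, p, q), zeta_tt X z, zeta_ts X z, zeta_ss X z))"

definition lie_apply :: "('a::real_normed_vector \<Rightarrow> 'a) \<Rightarrow> ('a \<Rightarrow> real) \<Rightarrow> 'a \<Rightarrow> real" where
  "lie_apply V f = (\<lambda>z. frechet_derivative f (at z) (V z))"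

(* X L + L (D_t xi_t + D_s xi_s) = D_t B1 + D_s B2, identically in the jet variables over \<Omega>. *)
definition noether_identity ::
  "jet0 set \<Rightarrow> (jet1 \<Rightarrow> real) \<Rightarrow> pvf \<Rightarrow> (jet0 \<Rightarrow> real) \<Rightarrow> (jet0 \<Rightarrow> real) \<Rightarrow> bool" where
  "noether_identity \<Omega> L X B1 B2 \<longleftrightarrow>
     (\<forall>z\<in>jets1 \<Omega>. lie_apply (prolong1 X) L z + L z * (Dt0 (xi_t X) z + Ds0 (xi_s X) z)
                   = Dt0 B1 z + Ds0 B2 z)"

definition noether_symmetry :: "jet0 set \<Rightarrow> (jet1 \<Rightarrow> real) \<Rightarrow> pvf \<Rightarrow> bool" where
  "noether_symmetry \<Omega> L X \<longleftrightarrow> smooth_on \<Omega> X \<and>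
     (\<exists>B1 B2. smooth_on \<Omega> B1 \<and> smooth_on \<Omega> B2 \<and> noether_identity \<Omega> L X B1 B2)"

definition variational_symmetry :: "jet0 set \<Rightarrow> (jet1 \<Rightarrow> real) \<Rightarrow> pvf \<Rightarrow> bool" where
  "variational_symmetry \<Omega> L X \<longleftrightarrow> smooth_on \<Omega> X \<and> noether_identity \<Omega> L X (\<lambda>_. 0) (\<lambda>_. 0)"

definition point_symmetry :: "jet0 set \<Rightarrow> (jet2 \<Rightarrow> real) \<Rightarrow> pvf \<Rightarrow> bool" where
  "point_symmetry \<Omega> F X \<longleftrightarrow> smooth_on \<Omega> X \<and>
     (\<forall>z\<in>jets2 \<Omega>. F z = 0 \<longrightarrow> lie_apply (prolong2 X) F z = 0)"

definition euler_lagrange :: "(jet1 \<Rightarrow> real) \<Rightarrow> jet2 \<Rightarrow> real" where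
  "euler_lagrange L = (\<lambda>(t, s, u, p, q, r, m, w).
     frechet_derivative L (at (t, s, u, p, q)) (0, 0, 1, 0, 0)
     - Dt1 (\<lambda>z. frechet_derivative L (at z) (0, 0, 0, 1, 0)) (t, s, u, p, q, r, m, w)
     - Ds1 (\<lambda>z. frechet_derivative L (at z) (0, 0, 0, 0, 1)) (t, s, u, p, q, r, m, w))"

(* D_t Tt + D_s Ts = 0 on the solution manifold F = 0 in the jet space over \<Omega>. *)
definition conservation_law ::
  "jet0 set \<Rightarrow> (jet2 \<Rightarrow> real) \<Rightarrow> (jet1 \<Rightarrow> real) \<Rightarrow> (jet1 \<Rightarrow> real) \<Rightarrow> bool" where
  "conservation_law \<Omega> F Tt Ts \<longleftrightarrow> (\<forall>z\<in>jets2 \<Omega>. F z = 0 \<longrightarrow> Dt1 Tt z + Ds1 Ts z = 0)"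

(* The densities that Noether's theorem attaches to a variational symmetry (B1 = B2 = 0). *)

definition noether_density_t :: "(jet1 \<Rightarrow> real) \<Rightarrow> pvf \<Rightarrow> jet1 \<Rightarrow> real" where
  "noether_density_t L X = (\<lambda>(t, s, u, p, q).
     xi_t X (t, s, u) * L (t, s, u, p, q)
     + (eta X (t, s, u) - xi_t X (t, s, u) * p - xi_s X (t, s, u) * q)
       * frechet_derivative L (at (t, s, u, p, q)) (0, 0, 0, 1, 0))"

definition noether_density_s :: "(jet1 \<Rightarrow> real) \<Rightarrow> pvf \<Rightarrow> jet1 \<Rightarrow> real" where
  "noether_density_s L X = (\<lambda>(t, s, u, p, q).
     xi_s X (t, s, u) * L (t, s, u, p, q)
     + (eta X (t, s, u) - xi_t X (t, s, u) * p - xi_s X (t, s, u) * q)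
       * frechet_derivative L (at (t, s, u, p, q)) (0, 0, 0, 0, 1))"

(* phi^(n (1 - gamma)), written as a power of phi^n: for n = 0 the variable phi may be zero or
   negative and the factor is 1, whereas u powr 0 would give 0 at u = 0. *)
definition phi_pow :: "nat \<Rightarrow> real \<Rightarrow> real \<Rightarrow> real" where
  "phi_pow n \<gamma> u = (u ^ n) powr (1 - \<gamma>)"

definition gas_lagrangian :: "nat \<Rightarrow> real \<Rightarrow> (real \<Rightarrow> real) \<Rightarrow> jet1 \<Rightarrow> real" where
  "gas_lagrangian n \<gamma> S = (\<lambda>(t, s, u, p, q).
     p\<^sup>2 / 2 - S s / (\<gamma> - 1) * phi_pow n \<gamma> u * q powr (1 - \<gamma>))"

definition gas_equation :: "nat \<Rightarrow> real \<Rightarrow> (real \<Rightarrow> real) \<Rightarrow> jet2 \<Rightarrow> real" where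
  "gas_equation n \<gamma> S = (\<lambda>(t, s, u, p, q, r, m, w).
     r + phi_pow n \<gamma> u * q powr (- \<gamma>)
         * (deriv S s - real n * \<gamma> * S s * (q / u) - \<gamma> * S s * (w / q)))"

definition gamma_star :: "nat \<Rightarrow> real" where
  "gamma_star n = (real n + 3) / (real n + 1)"

definition V_t :: pvf where "V_t = (\<lambda>(t, s, u). (1, 0, 0))"
definition V_phi :: pvf where "V_phi = (\<lambda>(t, s, u). (0, 0, 1))"
definition V_tphi :: pvf where "V_tphi = (\<lambda>(t, s, u). (0, 0, t))"
definition V_scale :: pvf where "V_scale = (\<lambda>(t, s, u). (2 * t, 0, u))"
definition V_proj :: pvf where "V_proj = (\<lambda>(t, s, u). (t\<^sup>2, 0, t * u))"

(* Basis of the Noether symmetries valid for arbitrary entropy S(s). *)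
definition arbitrary_entropy_symmetries :: "nat \<Rightarrow> real \<Rightarrow> pvf set" where
  "arbitrary_entropy_symmetries n \<gamma> =
     {V_t} \<union> (if n = 0 then {V_phi, V_tphi} else {})
           \<union> (if \<gamma> = gamma_star n then {V_scale, V_proj} else {})"

definition Z2 :: pvf where "Z2 = (\<lambda>(t, s, u). (0, 1, 0))"

definition Z3 :: "nat \<Rightarrow> real \<Rightarrow> pvf" where
  "Z3 n \<gamma> = (\<lambda>(t, s, u).
     (((real n + 3) * \<gamma> - real n - 1) * t, ((real n + 1) * \<gamma> - real n - 3) * s, (\<gamma> + 1) * u))"

(* Membership on \<Omega> in the real linear span of a finite set of vector fields. *)
definition in_span_on :: "jet0 set \<Rightarrow> pvf set \<Rightarrow> pvf \<Rightarrow> bool" where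
  "in_span_on \<Omega> G X \<longleftrightarrow> (\<exists>c. \<forall>x\<in>\<Omega>. X x = (\<Sum>Z\<in>G. c Z *\<^sub>R Z x))"

definition T2_t :: "jet1 \<Rightarrow> real" where
  "T2_t = (\<lambda>(t, s, u, p, q). - q * p)"

definition T2_s :: "nat \<Rightarrow> real \<Rightarrow> (real \<Rightarrow> real) \<Rightarrow> jet1 \<Rightarrow> real" where
  "T2_s n \<gamma> S = (\<lambda>(t, s, u, p, q).
     p\<^sup>2 / 2 - \<gamma> * S s / (\<gamma> - 1) * phi_pow n \<gamma> u * q powr (1 - \<gamma>))"

definition T3_t :: "nat \<Rightarrow> real \<Rightarrow> (real \<Rightarrow> real) \<Rightarrow> jet1 \<Rightarrow> real" where
  "T3_t n \<gamma> S = (\<lambda>(t, s, u, p, q).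
     - ((real n + 3) * \<gamma> - real n - 1) * t
         * (p\<^sup>2 / 2 + S s / (\<gamma> - 1) * phi_pow n \<gamma> u * q powr (1 - \<gamma>))
     - ((real n + 1) * \<gamma> - real n - 3) * s * q * p
     + (\<gamma> + 1) * u * p)"

(* phi^(- n gamma + n + 1) = phi^(n (1 - gamma)) * phi *)
definition T3_s :: "nat \<Rightarrow> real \<Rightarrow> (real \<Rightarrow> real) \<Rightarrow> jet1 \<Rightarrow> real" where
  "T3_s n \<gamma> S = (\<lambda>(t, s, u, p, q).
     - ((real n + 3) * \<gamma> - real n - 1) * t * S s * phi_pow n \<gamma> u * p * q powr (- \<gamma>)
     + ((real n + 1) * \<gamma> - real n - 3) * s
         * (p\<^sup>2 / 2 - \<gamma> * S s / (\<gamma> - 1) * phi_pow n \<gamma> u * q powr (1 - \<gamma>))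
     + (\<gamma> + 1) * S s * (phi_pow n \<gamma> u * u) * q powr (- \<gamma>))"

end

(* For a variational symmetry X the densities are those of Noether's theorem, and their divergence
   is the characteristic eta - xi^t p - xi^s q times the left-hand side of the equation.

   For the classification, the Noether identity over a fixed base point is a cubic polynomial in
   p = phi_t whose coefficients are combinations of 1, q, q^(-gamma), q^(1-gamma) in q = phi_s.
   These functions are linearly independent, so the identity splits into linear equations for the
   first derivatives of the coefficients of X and of B_1, B_2.  Differentiating them, with equality
   of mixed partials, gives xi^s_ss = 0, xi^t_ttt = 0 and eta_tt = 0; since the domain is open and
   connected, vanishing gradients integrate to
     xi^t = a t^2 + b t + c,  xi^s = d s + e,  eta = u (a t + f) + g t + h,
   where the remaining relations between a, b, d, f, g, h cut out exactly the span of the listed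
   fields. *)

theory Submission
  imports Defs
begin

subsection \<open>Directional derivatives of smooth functions\<close>

text \<open>The Noether point symmetries and the claimed span are compared through a third set: the
  fields that equal some \<open>quad_field\<close> with \<open>admissible\<close> parameters on
  \<Omega>. Solving the Noether identity leads into it, substitution into the Noether identity and
  the linearised equation leads back, and linear algebra in the parameters identifies it with the
  span. The coefficients of Z3 come from the relations among the parameters. The kinetic term forces
  2 f = b - d. Eliminating f from the potential term leaves b N = d M with N = (n+1) gamma - n - 3
  and M = (n+3) gamma - n - 1; the solution b = M, d = N has f = (M - N)/2 = gamma + 1. The part of
  the potential term linear in t is a N = 0, so the projective field appears exactly when N = 0,
  that is, gamma = gamma_*. Two obstacles shape the calculations. Coefficients are known only on
  \<Omega>, so formulas are differentiated through local congruence. For n = 0 the value u = 0 is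
  admissible, so derivatives in u are expressed through \<open>real n / u\<close>, which is then
  0.\<close>

definition dird :: "'a::real_normed_vector \<Rightarrow> ('a \<Rightarrow> 'b::real_normed_vector) \<Rightarrow> 'a \<Rightarrow> 'b" where
  "dird v f = (\<lambda>x. frechet_derivative f (at x) v)"

lemma dird_eqI: "(f has_derivative f') (at x) \<Longrightarrow> dird v f x = f' v"
  by (metis dird_def frechet_derivative_at)

text \<open>The derivative relation is local, and \<open>frechet_derivative\<close> is chosen from
  that relation alone. Hence a formula known only on an open set can be differentiated
  there.\<close>

lemma dird_cong:
  assumes "open D" "x \<in> D" "\<And>y. y \<in> D \<Longrightarrow> f y = g y"
  shows "dird v f x = dird v g x"
proof -
  have "(f has_derivative F) (at x) \<longleftrightarrow> (g has_derivative F) (at x)" for F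
    using assms has_derivative_transform_within_open[OF _ assms(1,2)] by metis
  then show ?thesis by (simp add: dird_def frechet_derivative_def)
qed

lemma Ck_on_cong:
  assumes "open D" "\<And>x. x \<in> D \<Longrightarrow> f x = g x" "Ck_on k D f"
  shows "Ck_on k D g"
  using assms(2,3)
proof (induction k arbitrary: f g)
  case 0
  then show ?case by (auto cong: continuous_on_cong)
next
  case (Suc k)
  have "g differentiable (at x)" if "x \<in> D" for x
  proof -
    obtain F where "(f has_derivative F) (at x)"
      using Suc.prems(2) \<open>x \<in> D\<close> by (auto simp: differentiable_def)
    then have "(g has_derivative F) (at x)"
      by (rule has_derivative_transform_within_open[OF _ assms(1) \<open>x \<in> D\<close> Suc.prems(1)])
    then show ?thesis by (auto simp: differentiable_def)
  qed
  moreover have "Ck_on k D (\<lambda>x. frechet_derivative g (at x) v)" for v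
  proof (rule Suc.IH)
    show "Ck_on k D (\<lambda>x. frechet_derivative f (at x) v)" using Suc.prems by simp
    show "frechet_derivative f (at x) v = frechet_derivative g (at x) v" if "x \<in> D" for x
      using dird_cong[OF assms(1) that Suc.prems(1)] by (simp add: dird_def)
  qed
  ultimately show ?case by simp
qed

lemma smooth_on_cong:
  assumes "open D" "\<And>x. x \<in> D \<Longrightarrow> f x = g x"
  shows "smooth_on D f \<longleftrightarrow> smooth_on D g"
  unfolding smooth_on_def using Ck_on_cong[OF assms(1)] assms(2) by metis

text \<open>Applied to coordinate projections, it carries smoothness from a vector field to its
  three coefficients.\<close>

lemma Ck_on_bounded_linear:
  fixes f :: "'a::euclidean_space \<Rightarrow> 'b::real_normed_vector"
  assumes "open D" "bounded_linear h" "Ck_on k D f"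
  shows "Ck_on k D (\<lambda>x. h (f x))"
  using assms(3)
proof (induction k arbitrary: f)
  case 0
  then show ?case
    by (simp add: bounded_linear.continuous_on[OF assms(2)])
next
  case (Suc k)
  have der: "((\<lambda>x. h (f x)) has_derivative (\<lambda>v. h (dird v f x))) (at x)" if "x \<in> D" for x
  proof (rule bounded_linear.has_derivative[OF assms(2)])
    show "(f has_derivative (\<lambda>v. dird v f x)) (at x)"
      using Suc.prems that by (auto simp: dird_def frechet_derivative_works)
  qed
  have "Ck_on k D (\<lambda>x. frechet_derivative (\<lambda>x. h (f x)) (at x) v)" for v
  proof (rule Ck_on_cong[OF assms(1)])
    show "Ck_on k D (\<lambda>x. h (dird v f x))"
      using Suc by (simp add: dird_def)
    show "h (dird v f x) = frechet_derivative (\<lambda>x. h (f x)) (at x) v" if "x \<in> D" for x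
      using dird_eqI[OF der[OF that], of v] by (simp add: dird_def)
  qed
  then show ?case using der by (auto simp: differentiable_def)
qed

lemma smooth_on_bounded_linear:
  "open D \<Longrightarrow> bounded_linear h \<Longrightarrow> smooth_on D f \<Longrightarrow> smooth_on D (\<lambda>x. h (f x))"
  by (simp add: smooth_on_def Ck_on_bounded_linear)

lemma smooth_on_dird: "smooth_on D f \<Longrightarrow> smooth_on D (dird v f)"
  unfolding smooth_on_def dird_def by (metis Ck_on.simps(2))

lemma smooth_on_has_derivative:
  "smooth_on D f \<Longrightarrow> x \<in> D \<Longrightarrow> (f has_derivative (\<lambda>v. dird v f x)) (at x)"
  unfolding smooth_on_def dird_def by (metis Ck_on.simps(2) frechet_derivative_works)

lemma smooth_on_continuous_on: "smooth_on D f \<Longrightarrow> continuous_on D f"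
  unfolding smooth_on_def by (metis Ck_on.simps(1))

section \<open>Linearity in the direction and symmetry of second derivatives\<close>

lemma dird_add: "f differentiable (at x) \<Longrightarrow> dird (v + w) f x = dird v f x + dird w f x"
  unfolding dird_def using linear_frechet_derivative linear_add by blast

lemma dird_scaleR: "f differentiable (at x) \<Longrightarrow> dird (c *\<^sub>R v) f x = c *\<^sub>R dird v f x"
  unfolding dird_def using linear_frechet_derivative linear_scale by blast

text \<open>The mean value theorem is used twice: along v for the increment of f across h w, then
  along w for \<open>dird v f\<close>. The second difference on the left is symmetric in v and w,
  which is what makes the mixed derivatives comparable.\<close>

lemma second_difference:
  fixes f :: "'a::euclidean_space \<Rightarrow> real"
  assumes f: "smooth_on D f" and h: "h > 0"
    and D: "\<And>\<sigma> \<tau>. 0 \<le> \<sigma> \<Longrightarrow> \<sigma> \<le> h \<Longrightarrow> 0 \<le> \<tau> \<Longrightarrow> \<tau> \<le> h \<Longrightarrow> x + \<sigma> *\<^sub>R v + \<tau> *\<^sub>R w \<in> D"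
  obtains \<sigma> \<tau> where "0 < \<sigma>" "\<sigma> < h" "0 < \<tau>" "\<tau> < h"
    "f (x + h *\<^sub>R v + h *\<^sub>R w) - f (x + h *\<^sub>R v) - f (x + h *\<^sub>R w) + f x
      = h\<^sup>2 * dird w (dird v f) (x + \<sigma> *\<^sub>R v + \<tau> *\<^sub>R w)"
proof -
  \<comment> \<open>Keeping \<open>0 *\<^sub>R w\<close> makes both terms instances of
    \<open>along_v\<close>, with \<tau> = h and \<tau> = 0.\<close>
  define g where "g \<sigma> = f (x + \<sigma> *\<^sub>R v + h *\<^sub>R w) - f (x + \<sigma> *\<^sub>R v + 0 *\<^sub>R w)" for \<sigma>
  have along_v: "((\<lambda>\<sigma>. f (x + \<sigma> *\<^sub>R v + \<tau> *\<^sub>R w)) has_real_derivative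
      dird v f (x + \<sigma> *\<^sub>R v + \<tau> *\<^sub>R w)) (at \<sigma>)"
    if "0 \<le> \<sigma>" "\<sigma> \<le> h" "0 \<le> \<tau>" "\<tau> \<le> h" for \<sigma> \<tau>
  proof -
    have "((\<lambda>\<sigma>. x + \<sigma> *\<^sub>R v + \<tau> *\<^sub>R w) has_derivative (\<lambda>c. c *\<^sub>R v)) (at \<sigma>)"
      by (auto intro!: derivative_eq_intros)
    from has_derivative_compose[OF this smooth_on_has_derivative[OF f D[OF that]]]
    show ?thesis
      using smooth_on_has_derivative[OF f D[OF that]]
      by (simp add: has_field_derivative_def dird_scaleR differentiableI mult.commute[of _ "dird _ _ _"])
  qed
  have along_w: "((\<lambda>\<tau>. dird v f (x + \<sigma> *\<^sub>R v + \<tau> *\<^sub>R w)) has_real_derivative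
      dird w (dird v f) (x + \<sigma> *\<^sub>R v + \<tau> *\<^sub>R w)) (at \<tau>)"
    if "0 \<le> \<sigma>" "\<sigma> \<le> h" "0 \<le> \<tau>" "\<tau> \<le> h" for \<sigma> \<tau>
  proof -
    note f' = smooth_on_has_derivative[OF smooth_on_dird[OF f, of v] D[OF that]]
    have "((\<lambda>\<tau>. x + \<sigma> *\<^sub>R v + \<tau> *\<^sub>R w) has_derivative (\<lambda>c. c *\<^sub>R w)) (at \<tau>)"
      by (auto intro!: derivative_eq_intros)
    from has_derivative_compose[OF this f'] show ?thesis
      using f' by (simp add: has_field_derivative_def dird_scaleR differentiableI
          mult.commute[of _ "dird _ _ _"])
  qed
  obtain \<sigma> where \<sigma>: "0 < \<sigma>" "\<sigma> < h" and g: "g h - g 0 = (h - 0) *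
      (dird v f (x + \<sigma> *\<^sub>R v + h *\<^sub>R w) - dird v f (x + \<sigma> *\<^sub>R v + 0 *\<^sub>R w))"
  proof -
    have "(g has_real_derivative dird v f (x + \<sigma> *\<^sub>R v + h *\<^sub>R w)
        - dird v f (x + \<sigma> *\<^sub>R v + 0 *\<^sub>R w)) (at \<sigma>)" if "0 \<le> \<sigma>" "\<sigma> \<le> h" for \<sigma>
      unfolding g_def using that h by (intro DERIV_diff along_v) auto
    from MVT2[OF h this] show ?thesis using that by blast
  qed
  obtain \<tau> where \<tau>: "0 < \<tau>" "\<tau> < h" and
    "dird v f (x + \<sigma> *\<^sub>R v + h *\<^sub>R w) - dird v f (x + \<sigma> *\<^sub>R v + 0 *\<^sub>R w)
      = (h - 0) * dird w (dird v f) (x + \<sigma> *\<^sub>R v + \<tau> *\<^sub>R w)"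
    using MVT2[of 0 h "\<lambda>\<tau>. dird v f (x + \<sigma> *\<^sub>R v + \<tau> *\<^sub>R w)"
        "\<lambda>\<tau>. dird w (dird v f) (x + \<sigma> *\<^sub>R v + \<tau> *\<^sub>R w)"] h \<sigma> along_w[of \<sigma>] by auto
  with g have "f (x + h *\<^sub>R v + h *\<^sub>R w) - f (x + h *\<^sub>R v) - f (x + h *\<^sub>R w) + f x
      = h\<^sup>2 * dird w (dird v f) (x + \<sigma> *\<^sub>R v + \<tau> *\<^sub>R w)"
    by (simp add: g_def power2_eq_square)
  with \<sigma> \<tau> show ?thesis using that by blast
qed

text \<open>Using \<open>second_difference\<close> in both orders expresses one quotient as either
  mixed derivative, at two points within O(h) of x. Continuity of the second derivatives then allows
  h to tend to 0.\<close>

lemma dird_commute: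
  fixes f :: "'a::euclidean_space \<Rightarrow> real"
  assumes D: "open D" "x \<in> D" and f: "smooth_on D f"
  shows "dird v (dird w f) x = dird w (dird v f) x"
proof -
  obtain e where e: "e > 0" "ball x e \<subseteq> D" using D open_contains_ball by blast
  \<comment> \<open>For h < k the parallelogram at x with sides h v and h w stays in the ball; the
    summand 1 keeps the denominator positive when v and w both vanish.\<close>
  define k where "k = e / (norm v + norm w + 1)"
  have k: "k > 0" unfolding k_def using e by (simp add: add_nonneg_pos)
  have near: "dist x (x + \<sigma> *\<^sub>R v + \<tau> *\<^sub>R w) \<le> h * (norm v + norm w)"
    if "0 \<le> \<sigma>" "\<sigma> \<le> h" "0 \<le> \<tau>" "\<tau> \<le> h" for \<sigma> \<tau> h
  proof -
    have "dist x (x + \<sigma> *\<^sub>R v + \<tau> *\<^sub>R w) = norm (\<sigma> *\<^sub>R v + \<tau> *\<^sub>R w)"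
      by (metis add.assoc add_diff_cancel_left' dist_commute dist_norm)
    also have "\<dots> \<le> \<sigma> * norm v + \<tau> * norm w"
      using norm_triangle_ineq[of "\<sigma> *\<^sub>R v" "\<tau> *\<^sub>R w"] that by simp
    also have "\<dots> \<le> h * (norm v + norm w)"
      using that by (simp add: distrib_left add_mono mult_right_mono)
    finally show ?thesis .
  qed
  have mem: "x + \<sigma> *\<^sub>R v + \<tau> *\<^sub>R w \<in> D"
    if "0 \<le> \<sigma>" "\<sigma> \<le> h" "0 \<le> \<tau>" "\<tau> \<le> h" "h < k" for \<sigma> \<tau> h
  proof -
    have "h * (norm v + norm w) < e"
    proof -
      have "h * (norm v + norm w) \<le> h * (norm v + norm w + 1)"
        using that by (intro mult_left_mono) auto
      also have "\<dots> < k * (norm v + norm w + 1)"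
        using that by (intro mult_strict_right_mono) (auto simp: add_nonneg_pos)
      also have "\<dots> = e" unfolding k_def
        by (smt (verit) nonzero_divide_eq_eq norm_ge_zero)
      finally show ?thesis .
    qed
    then show ?thesis using near[OF that(1-4)] e by (auto simp: subset_iff)
  qed
  have "\<exists>y z. dist x y \<le> h * (norm v + norm w) \<and> dist x z \<le> h * (norm v + norm w) \<and>
      dird v (dird w f) y = dird w (dird v f) z" if h: "0 < h" "h < k" for h
  proof -
    obtain \<sigma> \<tau> where 1: "0 < \<sigma>" "\<sigma> < h" "0 < \<tau>" "\<tau> < h"
      "f (x + h *\<^sub>R v + h *\<^sub>R w) - f (x + h *\<^sub>R v) - f (x + h *\<^sub>R w) + f x
        = h\<^sup>2 * dird w (dird v f) (x + \<sigma> *\<^sub>R v + \<tau> *\<^sub>R w)"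
      using second_difference[OF f h(1), of x v w] mem[OF _ _ _ _ h(2)] by metis
    have swap: "x + \<sigma> *\<^sub>R w + \<tau> *\<^sub>R v = x + \<tau> *\<^sub>R v + \<sigma> *\<^sub>R w" for \<sigma> \<tau>
      by simp
    obtain \<sigma>' \<tau>' where 2: "0 < \<sigma>'" "\<sigma>' < h" "0 < \<tau>'" "\<tau>' < h"
      "f (x + h *\<^sub>R w + h *\<^sub>R v) - f (x + h *\<^sub>R w) - f (x + h *\<^sub>R v) + f x
        = h\<^sup>2 * dird v (dird w f) (x + \<sigma>' *\<^sub>R w + \<tau>' *\<^sub>R v)"
    proof (rule second_difference[OF f h(1), of x w v])
      show "x + \<sigma> *\<^sub>R w + \<tau> *\<^sub>R v \<in> D" if "0 \<le> \<sigma>" "\<sigma> \<le> h" "0 \<le> \<tau>" "\<tau> \<le> h" for \<sigma> \<tau>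
        unfolding swap using mem[OF that(3,4,1,2) h(2)] .
    qed blast
    have "h\<^sup>2 * dird w (dird v f) (x + \<sigma> *\<^sub>R v + \<tau> *\<^sub>R w)
        = h\<^sup>2 * dird v (dird w f) (x + \<tau>' *\<^sub>R v + \<sigma>' *\<^sub>R w)"
      using 1(5) 2(5) unfolding swap[of h h] swap[of \<sigma>' \<tau>'] by linarith
    then have "dird w (dird v f) (x + \<sigma> *\<^sub>R v + \<tau> *\<^sub>R w) = dird v (dird w f) (x + \<tau>' *\<^sub>R v + \<sigma>' *\<^sub>R w)"
      using h(1) by simp
    moreover have "dist x (x + \<sigma> *\<^sub>R v + \<tau> *\<^sub>R w) \<le> h * (norm v + norm w)"
      using 1 by (intro near) auto
    moreover have "dist x (x + \<tau>' *\<^sub>R v + \<sigma>' *\<^sub>R w) \<le> h * (norm v + norm w)"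
      using 2 by (intro near) auto
    ultimately show ?thesis by metis
  qed
  then obtain Y Z where YZ: "\<And>h. 0 < h \<Longrightarrow> h < k \<Longrightarrow>
      dist x (Y h) \<le> h * (norm v + norm w) \<and> dist x (Z h) \<le> h * (norm v + norm w) \<and>
      dird v (dird w f) (Y h) = dird w (dird v f) (Z h)" by metis
  have ev: "\<forall>\<^sub>F h in at_right 0. 0 < h \<and> h < k"
    using k eventually_at_right_less eventually_at_right_field by blast
  have lim0: "((\<lambda>h. h * (norm v + norm w)) \<longlongrightarrow> 0) (at_right 0)"
    by (auto intro!: tendsto_eq_intros)
  have lim: "(U \<longlongrightarrow> x) (at_right 0)"
    if "\<And>h. 0 < h \<Longrightarrow> h < k \<Longrightarrow> dist x (U h) \<le> h * (norm v + norm w)" for U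
    unfolding tendsto_dist_iff[of U]
    by (rule tendsto_sandwich[OF _ _ tendsto_const lim0])
       (use that in \<open>auto simp: dist_commute intro: eventually_mono[OF ev]\<close>)
  have cont: "isCont (dird a (dird b f)) x" for a b
    using f D by (meson smooth_on_dird smooth_on_continuous_on continuous_on_eq_continuous_at)
  have "((\<lambda>h. dird v (dird w f) (Y h)) \<longlongrightarrow> dird v (dird w f) x) (at_right 0)"
    by (rule isCont_tendsto_compose[OF cont lim]) (use YZ in blast)
  moreover have "\<forall>\<^sub>F h in at_right 0. dird v (dird w f) (Y h) = dird w (dird v f) (Z h)"
    by (rule eventually_mono[OF ev]) (use YZ in blast)
  ultimately have "((\<lambda>h. dird w (dird v f) (Z h)) \<longlongrightarrow> dird v (dird w f) x) (at_right 0)"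
    by (rule Lim_transform_eventually)
  moreover have "((\<lambda>h. dird w (dird v f) (Z h)) \<longlongrightarrow> dird w (dird v f) x) (at_right 0)"
    by (rule isCont_tendsto_compose[OF cont lim]) (use YZ in blast)
  ultimately show ?thesis
    by (rule tendsto_unique[OF trivial_limit_at_right_real])
qed

lemma dird_apply: "frechet_derivative f (at x) v = dird v f x"
  by (simp add: dird_def)

subsection \<open>The Lagrangian and its Euler--Lagrange equation\<close>

text \<open>Dividing by \<open>g z\<close> instead of lowering the exponent keeps a single power as
  an atom, so later identities are rational in the remaining variables.\<close>

lemma has_derivative_powr_const:
  fixes g :: "'a::real_normed_vector \<Rightarrow> real"
  assumes "(g has_derivative g') (at z)" "g z > 0"
  shows "((\<lambda>z. g z powr c) has_derivative (\<lambda>h. c * g z powr c / g z * g' h)) (at z)"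
  by (rule has_derivative_eq_rhs[OF has_derivative_powr[OF assms(1) has_derivative_const assms(2)]])
     (auto simp: field_simps)

text \<open>Brings the exponents of the Lagrangian and of the equation to the one power
  \<open>q powr (- \<gamma>)\<close>.\<close>

lemma powr_one_minus: "(q::real) > 0 \<Longrightarrow> q powr (1 - \<gamma>) = q * q powr (- \<gamma>)"
  using powr_add[of q 1 "-\<gamma>"] by simp

lemma phi_pow_pos: "(n \<ge> 1 \<longrightarrow> u > 0) \<Longrightarrow> phi_pow n \<gamma> u > 0"
  by (cases n) (auto simp: phi_pow_def)

(* For n = 0 the factor real n / u below is 0 even at u = 0, so that n = 0 and n >= 1 share one formula. *)
lemma has_derivative_phi_pow:
  fixes g :: "'a::real_normed_vector \<Rightarrow> real"
  assumes g: "(g has_derivative g') (at z)" and pos: "n \<ge> 1 \<longrightarrow> g z > 0"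
  shows "((\<lambda>z. phi_pow n \<gamma> (g z)) has_derivative
    (\<lambda>h. (1 - \<gamma>) * phi_pow n \<gamma> (g z) * (real n / g z) * g' h)) (at z)"
proof (cases "n = 0")
  case True
  then show ?thesis by (simp add: phi_pow_def)
next
  case False
  then have gz: "g z > 0" using pos by simp
  have "((\<lambda>z. g z ^ n) has_derivative (\<lambda>h. real n * g' h * g z ^ (n - 1))) (at z)"
    by (rule has_derivative_power[OF g])
  from has_derivative_powr_const[OF this, of "1 - \<gamma>"] show ?thesis
    unfolding phi_pow_def
    by (rule has_derivative_eq_rhs)
       (use gz False in \<open>auto simp: field_simps power_eq_if[of "g z" n]\<close>)
qed

text \<open>\<open>real n / u\<close> is the logarithmic derivative of u^n, so it enters the
  equation and must itself be differentiated there. For n = 0 it is identically 0, also at u =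
  0.\<close>

lemma has_derivative_of_nat_over:
  fixes g :: "'a::real_normed_vector \<Rightarrow> real"
  assumes g: "(g has_derivative g') (at z)" and pos: "n \<ge> 1 \<longrightarrow> g z > 0"
  shows "((\<lambda>z. real n / g z) has_derivative (\<lambda>h. - (real n / g z / g z) * g' h)) (at z)"
proof (cases "n = 0")
  case False
  then show ?thesis using pos
    by (auto intro!: derivative_eq_intros g simp: field_simps)
qed simp

lemmas gas_derivative_intros =
  has_derivative_powr_const[THEN has_derivative_eq_rhs]
  has_derivative_phi_pow[THEN has_derivative_eq_rhs]
  has_derivative_of_nat_over[THEN has_derivative_eq_rhs]

section \<open>Jet domains, and total derivatives as directional derivatives\<close>

lemma open_jets1: "open \<Omega> \<Longrightarrow> open (jets1 \<Omega>)"
proof -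
  assume "open \<Omega>"
  have "jets1 \<Omega> = (\<lambda>z. (fst z, fst (snd z), fst (snd (snd z)))) -` \<Omega>
      \<inter> {z. snd (snd (snd (snd z))) > 0}"
    by (auto simp: jets1_def)
  moreover have "open \<dots>"
    by (intro open_Int open_vimage[OF \<open>open \<Omega>\<close>] open_Collect_less continuous_intros)
  ultimately show ?thesis by simp
qed

lemma open_base_domain: "open (base_domain n)"
proof (cases "n = 0")
  case False
  then have "base_domain n = {z. snd (snd z) > 0}" by (auto simp: base_domain_def)
  moreover have "open {z :: jet0. snd (snd z) > 0}" by (intro open_Collect_less continuous_intros)
  ultimately show ?thesis by simp
next
  case True
  then have "base_domain n = UNIV" by (auto simp: base_domain_def)
  then show ?thesis by simp
qed

lemma mem_jets1 [simp]: "(t, s, u, p, q) \<in> jets1 \<Omega> \<longleftrightarrow> (t, s, u) \<in> \<Omega> \<and> q > 0"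
  by (simp add: jets1_def)

lemma mem_jets2 [simp]: "(t, s, u, p, q, r, m, w) \<in> jets2 \<Omega> \<longleftrightarrow> (t, s, u) \<in> \<Omega> \<and> q > 0"
  by (simp add: jets2_def)

lemma mem_base_domain [simp]: "(t, s, u) \<in> base_domain n \<longleftrightarrow> (n \<ge> 1 \<longrightarrow> u > 0)"
  by (simp add: base_domain_def)

lemma total_derivatives:
  "Dt0 f (t, s, u, p, q) = dird (1, 0, p) f (t, s, u)"
  "Ds0 f (t, s, u, p, q) = dird (0, 1, q) f (t, s, u)"
  "Dt1 g (t, s, u, p, q, r, m, w) = dird (1, 0, p, r, m) g (t, s, u, p, q)"
  "Ds1 g (t, s, u, p, q, r, m, w) = dird (0, 1, q, m, w) g (t, s, u, p, q)"
  by (simp_all add: Dt0_def Ds0_def Dt1_def Ds1_def dird_def)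

lemma dird_Pair:
  fixes f :: "jet0 \<Rightarrow> real"
  assumes "f differentiable (at x)"
  shows "dird (a, b, c) f x = a * dird (1,0,0) f x + b * dird (0,1,0) f x + c * dird (0,0,1) f x"
proof -
  have "dird (a, b, c) f x = dird (a *\<^sub>R (1,0,0) + (b *\<^sub>R (0,1,0) + c *\<^sub>R (0,0,1))) f x"
    by simp
  then show ?thesis by (simp only: dird_add[OF assms] dird_scaleR[OF assms]) simp
qed

section \<open>First derivatives of the Lagrangian and of the equation\<close>

context
  fixes n :: nat and \<gamma> A :: real
  assumes \<gamma>: "\<gamma> > 1"
begin

lemma has_derivative_gas_lagrangian:
  assumes "q > 0" "n \<ge> 1 \<longrightarrow> u > 0"
  shows "(gas_lagrangian n \<gamma> (\<lambda>_. A) has_derivative (\<lambda>(dt, ds, du, dp, dq).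
      p * dp + A * phi_pow n \<gamma> u * (real n / u) * q powr (1 - \<gamma>) * du
      + A * phi_pow n \<gamma> u * q powr (- \<gamma>) * dq)) (at (t, s, u, p, q))"
proof -
  \<comment> \<open>Writing A as (gamma - 1) B removes the denominator gamma - 1, so that only q and
    u remain to be cleared.\<close>
  define B where "B = A / (\<gamma> - 1)"
  have A: "A = (\<gamma> - 1) * B" using \<gamma> by (simp add: B_def)
  show ?thesis
    unfolding gas_lagrangian_def case_prod_unfold B_def[symmetric] unfolding A
    using assms
    by (cases "n = 0"; auto intro!: derivative_eq_intros gas_derivative_intros
        simp: fun_eq_iff powr_one_minus field_simps)
qed

lemmas dird_gas_lagrangian = dird_eqI[OF has_derivative_gas_lagrangian]

lemma has_derivative_gas_equation:
  assumes "q > 0" "n \<ge> 1 \<longrightarrow> u > 0"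
  shows "(gas_equation n \<gamma> (\<lambda>_. A) has_derivative (\<lambda>(dt, ds, du, dp, dq, dr, dm, dw).
      dr - \<gamma> * A * phi_pow n \<gamma> u * q powr (- \<gamma>) *
       ((1 - \<gamma>) * (real n / u) * (real n / u * q + w / q) * du
        - \<gamma> / q * (real n / u * q + w / q) * dq
        - real n / u / u * q * du + real n / u * dq + dw / q - w / (q * q) * dq)))
      (at (t, s, u, p, q, r, m, w))"
proof -
  \<comment> \<open>Since S' = 0, the spatial part is a multiple of n q / u + w / q, the factor that
    splits off in the symmetry condition.\<close>
  have eq: "gas_equation n \<gamma> (\<lambda>_. A) = (\<lambda>z. case z of (t, s, u, p, q, r, m, w) \<Rightarrow>
      r - \<gamma> * A * phi_pow n \<gamma> u * q powr (- \<gamma>) * (real n / u * q + w / q))"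
    unfolding gas_equation_def by (auto simp: fun_eq_iff algebra_simps)
  show ?thesis
    unfolding eq case_prod_unfold using assms
    by (cases "n = 0"; auto intro!: derivative_eq_intros gas_derivative_intros
        simp: fun_eq_iff field_simps)
qed

text \<open>The sign arises from L_p = p, whose contribution is - D_t L_p = - phi_tt.\<close>

lemma euler_lagrange_gas:
  assumes q: "q > 0" and u: "n \<ge> 1 \<longrightarrow> u > 0"
  shows "euler_lagrange (gas_lagrangian n \<gamma> (\<lambda>_. A)) (t, s, u, p, q, r, m, w)
    = - gas_equation n \<gamma> (\<lambda>_. A) (t, s, u, p, q, r, m, w)"
proof -
  let ?L = "gas_lagrangian n \<gamma> (\<lambda>_. A)" and ?J = "jets1 (base_domain n)"
  have mem: "(t, s, u, p, q) \<in> ?J" using q u by simp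
  \<comment> \<open>The formulas for L_p and L_q hold only at admissible jets, so they are
    differentiated through congruence on that open set.\<close>
  note cong = dird_cong[OF open_jets1[OF open_base_domain] mem]
  have Lp: "dird v (dird (0,0,0,1,0) ?L) (t, s, u, p, q) = fst (snd (snd (snd v)))" for v
  proof -
    have "dird v (dird (0,0,0,1,0) ?L) (t, s, u, p, q)
        = dird v (\<lambda>(t, s, u, p, q). p) (t, s, u, p, q)"
      by (rule cong) (auto simp: dird_gas_lagrangian)
    also have "\<dots> = fst (snd (snd (snd v)))"
      unfolding case_prod_unfold by (rule dird_eqI) (auto intro!: derivative_eq_intros)
    finally show ?thesis .
  qed
  have Lq: "dird (a, b, c, d, e) (dird (0,0,0,0,1) ?L) (t, s, u, p, q) =
      A * phi_pow n \<gamma> u * q powr (- \<gamma>) * ((1 - \<gamma>) * (real n / u) * c - \<gamma> / q * e)" for a b c d e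
  proof -
    have "dird (a, b, c, d, e) (dird (0,0,0,0,1) ?L) (t, s, u, p, q)
        = dird (a, b, c, d, e) (\<lambda>(t, s, u, p, q). A * phi_pow n \<gamma> u * q powr (- \<gamma>)) (t, s, u, p, q)"
      by (rule cong) (auto simp: dird_gas_lagrangian)
    \<comment> \<open>The value is written as a map applied to the direction, so that
      \<open>dird_eqI\<close> can recover the derivative as a linear map.\<close>
    also have "\<dots> = (\<lambda>(a, b, c, d, e).
      A * phi_pow n \<gamma> u * q powr (- \<gamma>) * ((1 - \<gamma>) * (real n / u) * c - \<gamma> / q * e)) (a, b, c, d, e)"
      unfolding case_prod_unfold
      using q u by (intro dird_eqI, cases "n = 0"; auto intro!: derivative_eq_intros gas_derivative_intros
        simp: fun_eq_iff field_simps)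
    finally show ?thesis by simp
  qed
  show ?thesis
    using q u
    by (simp add: euler_lagrange_def total_derivatives Lp Lq dird_def[symmetric]
        dird_apply dird_gas_lagrangian gas_equation_def powr_one_minus)
       (cases "n = 0"; simp add: field_simps)
qed

end

subsection \<open>Noether densities and conservation laws\<close>

lemma noether_density_gas:
  assumes "\<gamma> > 1" "q > 0" "n \<ge> 1 \<longrightarrow> u > 0"
  shows "noether_density_t (gas_lagrangian n \<gamma> (\<lambda>_. A)) X (t, s, u, p, q) =
      xi_t X (t, s, u) * gas_lagrangian n \<gamma> (\<lambda>_. A) (t, s, u, p, q)
      + (eta X (t, s, u) - xi_t X (t, s, u) * p - xi_s X (t, s, u) * q) * p"
    "noether_density_s (gas_lagrangian n \<gamma> (\<lambda>_. A)) X (t, s, u, p, q) =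
      xi_s X (t, s, u) * gas_lagrangian n \<gamma> (\<lambda>_. A) (t, s, u, p, q)
      + (eta X (t, s, u) - xi_t X (t, s, u) * p - xi_s X (t, s, u) * q)
        * (A * phi_pow n \<gamma> u * q powr (- \<gamma>))"
  using assms
  by (simp_all add: noether_density_t_def noether_density_s_def dird_apply dird_gas_lagrangian)

lemma noether_density_Z2:
  assumes "\<gamma> > 1" "q > 0" "n \<ge> 1 \<longrightarrow> u > 0"
  shows "noether_density_t (gas_lagrangian n \<gamma> (\<lambda>_. A)) Z2 (t, s, u, p, q) = T2_t (t, s, u, p, q)"
    and "noether_density_s (gas_lagrangian n \<gamma> (\<lambda>_. A)) Z2 (t, s, u, p, q)
      = T2_s n \<gamma> (\<lambda>_. A) (t, s, u, p, q)"
  using assms unfolding noether_density_gas[OF assms]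
  by (simp_all add: Z2_def xi_t_def xi_s_def eta_def T2_t_def
      T2_s_def gas_lagrangian_def powr_one_minus) (simp_all add: field_simps power2_eq_square)

lemma noether_density_Z3:
  assumes "\<gamma> > 1" "q > 0" "n \<ge> 1 \<longrightarrow> u > 0"
  shows "noether_density_t (gas_lagrangian n \<gamma> (\<lambda>_. A)) (Z3 n \<gamma>) (t, s, u, p, q)
      = T3_t n \<gamma> (\<lambda>_. A) (t, s, u, p, q)"
    and "noether_density_s (gas_lagrangian n \<gamma> (\<lambda>_. A)) (Z3 n \<gamma>) (t, s, u, p, q)
      = T3_s n \<gamma> (\<lambda>_. A) (t, s, u, p, q)"
proof -
  define B where "B = A / (\<gamma> - 1)"
  have A: "A = (\<gamma> - 1) * B" using assms by (simp add: B_def)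
  show "noether_density_t (gas_lagrangian n \<gamma> (\<lambda>_. A)) (Z3 n \<gamma>) (t, s, u, p, q)
      = T3_t n \<gamma> (\<lambda>_. A) (t, s, u, p, q)"
    using assms unfolding noether_density_gas[OF assms]
    by (simp add: Z3_def xi_t_def xi_s_def eta_def T3_t_def gas_lagrangian_def powr_one_minus)
       (simp add: algebra_simps power2_eq_square)
  show "noether_density_s (gas_lagrangian n \<gamma> (\<lambda>_. A)) (Z3 n \<gamma>) (t, s, u, p, q)
      = T3_s n \<gamma> (\<lambda>_. A) (t, s, u, p, q)"
    using assms unfolding noether_density_gas[OF assms]
    by (simp add: Z3_def xi_t_def xi_s_def eta_def T3_s_def gas_lagrangian_def powr_one_minus
        times_divide_eq_right[symmetric] B_def[symmetric] del: times_divide_eq_right)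
       (simp add: A algebra_simps power2_eq_square)
qed

section \<open>Divergences of the densities, with the second-order jet variables free\<close>

context
  fixes n :: nat and \<gamma> A q u :: real
  assumes \<gamma>: "\<gamma> > 1" and q: "q > 0" and u: "n \<ge> 1 \<longrightarrow> u > 0"
begin

lemma divergence_T2:
  "Dt1 T2_t (t, s, u, p, q, r, m, w) + Ds1 (T2_s n \<gamma> (\<lambda>_. A)) (t, s, u, p, q, r, m, w)
    = - q * gas_equation n \<gamma> (\<lambda>_. A) (t, s, u, p, q, r, m, w)"
proof -
  define B where "B = A / (\<gamma> - 1)"
  have A: "A = (\<gamma> - 1) * B" using \<gamma> by (simp add: B_def)
  have 1: "dird (a, b, c, d, e) T2_t (t, s, u, p, q) = (\<lambda>(a, b, c, d, e). - q * d - p * e) (a, b, c, d, e)"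
    for a b c d e
    unfolding T2_t_def case_prod_unfold
    by (intro dird_eqI) (auto intro!: derivative_eq_intros)
  have 2: "dird (a, b, c, d, e) (T2_s n \<gamma> (\<lambda>_. A)) (t, s, u, p, q) = (\<lambda>(a, b, c, d, e).
      p * d + A * \<gamma> * phi_pow n \<gamma> u * q powr (- \<gamma>) * (real n / u * q * c + e)) (a, b, c, d, e)"
    for a b c d e
    unfolding T2_s_def case_prod_unfold times_divide_eq_right[symmetric] B_def[symmetric] unfolding A
    using q u
    by (intro dird_eqI, cases "n = 0"; auto intro!: derivative_eq_intros gas_derivative_intros
        simp: fun_eq_iff powr_one_minus field_simps)
  show ?thesis
    using q u unfolding total_derivatives 1 2 gas_equation_def
    by (cases "n = 0"; simp add: powr_one_minus field_simps)
qed

lemma divergence_T3: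
  "Dt1 (T3_t n \<gamma> (\<lambda>_. A)) (t, s, u, p, q, r, m, w)
     + Ds1 (T3_s n \<gamma> (\<lambda>_. A)) (t, s, u, p, q, r, m, w)
    = ((\<gamma> + 1) * u - ((real n + 3) * \<gamma> - real n - 1) * t * p
       - ((real n + 1) * \<gamma> - real n - 3) * s * q)
      * gas_equation n \<gamma> (\<lambda>_. A) (t, s, u, p, q, r, m, w)"
proof -
  define B where "B = A / (\<gamma> - 1)"
  have A: "A = (\<gamma> - 1) * B" using \<gamma> by (simp add: B_def)
  \<comment> \<open>These are the t- and s-weights of Z3. They stay opaque while denominators are
    cleared and are expanded only for the closing polynomial identity.\<close>
  define M N where "M = (real n + 3) * \<gamma> - real n - 1" and "N = (real n + 1) * \<gamma> - real n - 3"
  define W Q where "W = phi_pow n \<gamma> u" and "Q = q powr (- \<gamma>)"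
  have 1: "dird (a, b, c, d, e) (T3_t n \<gamma> (\<lambda>_. A)) (t, s, u, p, q) = (\<lambda>(a, b, c, d, e).
      - M * (p\<^sup>2 / 2 + B * W * q * Q) * a - N * q * p * b
      + (M * t * A * W * Q * (real n / u) * q + (\<gamma> + 1) * p) * c
      + (- M * t * p - N * s * q + (\<gamma> + 1) * u) * d
      + (M * t * A * W * Q - N * s * p) * e) (a, b, c, d, e)"
    for a b c d e
    unfolding T3_t_def case_prod_unfold M_def[symmetric] N_def[symmetric] B_def[symmetric]
      W_def Q_def unfolding A
    using q u
    by (intro dird_eqI, cases "n = 0"; auto intro!: derivative_eq_intros gas_derivative_intros
        simp: fun_eq_iff powr_one_minus field_simps)
  have 2: "dird (a, b, c, d, e) (T3_s n \<gamma> (\<lambda>_. A)) (t, s, u, p, q) = (\<lambda>(a, b, c, d, e).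
      - M * A * W * Q * p * a + N * (p\<^sup>2 / 2 - \<gamma> * B * W * q * Q) * b
      + (- M * t * A * W * Q * p * (1 - \<gamma>) * (real n / u) + N * s * \<gamma> * A * W * Q * q * (real n / u)
         + (\<gamma> + 1) * A * W * Q * (1 + (1 - \<gamma>) * real n)) * c
      + (- M * t * A * W * Q + N * s * p) * d
      + (M * t * A * W * Q * \<gamma> / q * p + N * s * \<gamma> * A * W * Q - (\<gamma> + 1) * A * W * u * \<gamma> * Q / q) * e)
      (a, b, c, d, e)" for a b c d e
    unfolding T3_s_def case_prod_unfold M_def[symmetric] N_def[symmetric]
      times_divide_eq_right[symmetric] B_def[symmetric] W_def Q_def unfolding A
    using q u
    by (intro dird_eqI, cases "n = 0"; auto intro!: derivative_eq_intros gas_derivative_intros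
        simp: fun_eq_iff powr_one_minus field_simps)
  have 3: "gas_equation n \<gamma> (\<lambda>_. A) (t, s, u, p, q, r, m, w)
      = r - \<gamma> * A * W * Q * (real n / u * q + w / q)"
    by (simp add: gas_equation_def W_def Q_def algebra_simps)
  show ?thesis
    using q u unfolding total_derivatives 1 2 3 M_def[symmetric] N_def[symmetric]
    unfolding A
    by (cases "n = 0"; simp add: field_simps power2_eq_square;
        simp add: M_def N_def algebra_simps power2_eq_square)
qed

end

subsection \<open>The candidate symmetries\<close>

text \<open>The parameter c belongs to \<open>V_t\<close>, e to \<open>Z2\<close>, h to
  \<open>V_phi\<close>, g to \<open>V_tphi\<close>, and b, d, f carry the scalings. The letter a
  occurs twice because \<open>V_proj\<close> couples t^2 in the first component with t u in the
  last.\<close>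

definition quad_field :: "real \<Rightarrow> real \<Rightarrow> real \<Rightarrow> real \<Rightarrow> real \<Rightarrow> real \<Rightarrow> real \<Rightarrow> real \<Rightarrow> pvf" where
  "quad_field a b c d e f g h =
     (\<lambda>(t, s, u). (a * t\<^sup>2 + b * t + c, d * s + e, u * (a * t + f) + g * t + h))"

text \<open>The first relation balances the kinetic term, the last one the potential term after f is
  eliminated. Translations g and h survive only without the factor u^n. The condition on a is gamma
  = gamma_* with the denominator cleared.\<close>

definition admissible :: "nat \<Rightarrow> real \<Rightarrow> real \<Rightarrow> real \<Rightarrow> real \<Rightarrow> real \<Rightarrow> real \<Rightarrow> real \<Rightarrow> bool" where
  "admissible n \<gamma> a b d f g h \<longleftrightarrow>
     2 * f = b - d \<and> (n \<ge> 1 \<longrightarrow> g = 0 \<and> h = 0) \<and> (a \<noteq> 0 \<longrightarrow> (real n + 1) * \<gamma> = real n + 3)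
     \<and> b * ((real n + 1) * \<gamma> - real n - 3) = d * ((real n + 3) * \<gamma> - real n - 1)"

text \<open>The span of 1, t, s, u, t^2, t u, u^2 with vector coefficients is closed under
  directional derivatives, so induction on the order works once the coefficients are generalised. It
  covers both \<open>quad_field\<close> and the function B1.\<close>

lemma smooth_on_quadratic:
  fixes k0 :: "'b::real_normed_vector"
  assumes "open D"
  shows "smooth_on D (\<lambda>x :: jet0. k0 + fst x *\<^sub>R k1 + fst (snd x) *\<^sub>R k2 + snd (snd x) *\<^sub>R k3
    + (fst x * fst x) *\<^sub>R k4 + (fst x * snd (snd x)) *\<^sub>R k5 + (snd (snd x) * snd (snd x)) *\<^sub>R k6)"
  unfolding smooth_on_def
proof
  fix k
  show "Ck_on k D (\<lambda>x :: jet0. k0 + fst x *\<^sub>R k1 + fst (snd x) *\<^sub>R k2 + snd (snd x) *\<^sub>R k3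
    + (fst x * fst x) *\<^sub>R k4 + (fst x * snd (snd x)) *\<^sub>R k5 + (snd (snd x) * snd (snd x)) *\<^sub>R k6)"
  proof (induction k arbitrary: k0 k1 k2 k3 k4 k5 k6)
    case 0
    show ?case by (auto intro!: continuous_intros)
  next
    case (Suc k)
    let ?f = "\<lambda>x :: jet0. k0 + fst x *\<^sub>R k1 + fst (snd x) *\<^sub>R k2 + snd (snd x) *\<^sub>R k3
      + (fst x * fst x) *\<^sub>R k4 + (fst x * snd (snd x)) *\<^sub>R k5 + (snd (snd x) * snd (snd x)) *\<^sub>R k6"
    have der: "(?f has_derivative (\<lambda>v. fst v *\<^sub>R k1 + fst (snd v) *\<^sub>R k2 + snd (snd v) *\<^sub>R k3
        + (2 * fst x * fst v) *\<^sub>R k4 + (fst x * snd (snd v) + fst v * snd (snd x)) *\<^sub>R k5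
        + (2 * snd (snd x) * snd (snd v)) *\<^sub>R k6)) (at x)" for x
      by (auto intro!: derivative_eq_intros simp: fun_eq_iff algebra_simps scaleR_2)
    have "Ck_on k D (\<lambda>x. frechet_derivative ?f (at x) v)" for v
    proof -
      have "(\<lambda>x. frechet_derivative ?f (at x) v) = (\<lambda>x :: jet0.
          (fst v *\<^sub>R k1 + fst (snd v) *\<^sub>R k2 + snd (snd v) *\<^sub>R k3)
          + fst x *\<^sub>R ((2 * fst v) *\<^sub>R k4 + snd (snd v) *\<^sub>R k5) + fst (snd x) *\<^sub>R 0
          + snd (snd x) *\<^sub>R (fst v *\<^sub>R k5 + (2 * snd (snd v)) *\<^sub>R k6)
          + (fst x * fst x) *\<^sub>R 0 + (fst x * snd (snd x)) *\<^sub>R 0 + (snd (snd x) * snd (snd x)) *\<^sub>R 0)"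
        unfolding frechet_derivative_at[OF der, symmetric] by (auto simp: fun_eq_iff algebra_simps)
      then show ?thesis using Suc.IH by (simp only:)
    qed
    then show ?case using der unfolding Ck_on.simps differentiable_def by blast
  qed
qed

lemma smooth_on_quad_field:
  assumes "open D" shows "smooth_on D (quad_field a b c d e f g h)"
proof -
  have "quad_field a b c d e f g h = (\<lambda>x. (c, e, h) + fst x *\<^sub>R (b, 0, g) + fst (snd x) *\<^sub>R (0, d, 0)
    + snd (snd x) *\<^sub>R (0, 0, f) + (fst x * fst x) *\<^sub>R (a, 0, 0) + (fst x * snd (snd x)) *\<^sub>R (0, 0, a)
    + (snd (snd x) * snd (snd x)) *\<^sub>R 0)"
    by (auto simp: quad_field_def fun_eq_iff algebra_simps power2_eq_square)
  then show ?thesis using smooth_on_quadratic[OF assms] by (simp only:)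
qed

section \<open>Fields in normal form: prolongation, Noether identity, point symmetry\<close>

context
  fixes n :: nat and \<gamma> A :: real and \<Omega> :: "jet0 set" and X :: pvf and a b c d e f g h :: real
  assumes \<gamma>: "\<gamma> > 1" and \<Omega>: "open \<Omega>" "\<Omega> \<subseteq> base_domain n"
    and X: "\<And>x. x \<in> \<Omega> \<Longrightarrow> X x = quad_field a b c d e f g h x"
begin

lemma components_quad_field:
  assumes "(t, s, u) \<in> \<Omega>"
  shows "xi_t X (t, s, u) = a * t\<^sup>2 + b * t + c" "xi_s X (t, s, u) = d * s + e"
    "eta X (t, s, u) = u * (a * t + f) + g * t + h"
  using X[OF assms] by (auto simp: xi_t_def xi_s_def eta_def quad_field_def)

lemma dird_components_quad_field:
  assumes x: "(t, s, u) \<in> \<Omega>"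
  shows "dird (v1, v2, v3) (xi_t X) (t, s, u) = (2 * a * t + b) * v1"
    "dird (v1, v2, v3) (xi_s X) (t, s, u) = d * v2"
    "dird (v1, v2, v3) (eta X) (t, s, u) = (a * t + f) * v3 + (a * u + g) * v1"
proof -
  note cong = dird_cong[OF \<Omega>(1) x]
  have "dird (v1, v2, v3) (xi_t X) (t, s, u) = dird (v1, v2, v3) (\<lambda>(t, s, u). a * t\<^sup>2 + b * t + c) (t, s, u)"
    by (rule cong) (auto simp: components_quad_field)
  also have "\<dots> = (\<lambda>(v1, v2, v3). (2 * a * t + b) * v1) (v1, v2, v3)"
    unfolding case_prod_unfold
    by (intro dird_eqI) (auto intro!: derivative_eq_intros simp: fun_eq_iff algebra_simps)
  finally show "dird (v1, v2, v3) (xi_t X) (t, s, u) = (2 * a * t + b) * v1" by simp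
  have "dird (v1, v2, v3) (xi_s X) (t, s, u) = dird (v1, v2, v3) (\<lambda>(t, s, u). d * s + e) (t, s, u)"
    by (rule cong) (auto simp: components_quad_field)
  also have "\<dots> = (\<lambda>(v1, v2, v3). d * v2) (v1, v2, v3)"
    unfolding case_prod_unfold
    by (intro dird_eqI) (auto intro!: derivative_eq_intros simp: fun_eq_iff algebra_simps)
  finally show "dird (v1, v2, v3) (xi_s X) (t, s, u) = d * v2" by simp
  have "dird (v1, v2, v3) (eta X) (t, s, u)
      = dird (v1, v2, v3) (\<lambda>(t, s, u). u * (a * t + f) + g * t + h) (t, s, u)"
    by (rule cong) (auto simp: components_quad_field)
  also have "\<dots> = (\<lambda>(v1, v2, v3). (a * t + f) * v3 + (a * u + g) * v1) (v1, v2, v3)"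
    unfolding case_prod_unfold
    by (intro dird_eqI) (auto intro!: derivative_eq_intros simp: fun_eq_iff algebra_simps)
  finally show "dird (v1, v2, v3) (eta X) (t, s, u) = (a * t + f) * v3 + (a * u + g) * v1" by simp
qed

lemma zeta_quad_field:
  assumes "(t, s, u) \<in> \<Omega>"
  shows "zeta_t X (t, s, u, p, q) = a * u + g + p * (f - b - a * t)"
    "zeta_s X (t, s, u, p, q) = q * (a * t + f - d)"
  using assms
  by (simp_all add: zeta_t_def zeta_s_def Let_def total_derivatives dird_components_quad_field
      algebra_simps)

lemma zeta2_quad_field:
  assumes x: "(t, s, u) \<in> \<Omega>" "q > 0"
  shows "zeta_tt X (t, s, u, p, q, r, m, w) = r * (f - 2 * b - 3 * a * t)"
    "zeta_ss X (t, s, u, p, q, r, m, w) = w * (a * t + f - 2 * d)"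
proof -
  have mem: "(t, s, u, p, q) \<in> jets1 \<Omega>" using x by simp
  note cong = dird_cong[OF open_jets1[OF \<Omega>(1)] mem]
  have "dird v (zeta_t X) (t, s, u, p, q)
      = dird v (\<lambda>(t, s, u, p, q). a * u + g + p * (f - b - a * t)) (t, s, u, p, q)" for v
    by (rule cong) (auto simp: zeta_quad_field)
  also have "\<dots> v = (\<lambda>(v1, v2, v3, v4, v5). a * v3 + v4 * (f - b - a * t) - p * a * v1) v" for v
    unfolding case_prod_unfold
    by (intro dird_eqI) (auto intro!: derivative_eq_intros simp: fun_eq_iff algebra_simps)
  finally show "zeta_tt X (t, s, u, p, q, r, m, w) = r * (f - 2 * b - 3 * a * t)"
    using x by (simp add: zeta_tt_def total_derivatives dird_components_quad_field algebra_simps)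
  have "dird v (zeta_s X) (t, s, u, p, q)
      = dird v (\<lambda>(t, s, u, p, q). q * (a * t + f - d)) (t, s, u, p, q)" for v
    by (rule cong) (auto simp: zeta_quad_field)
  also have "\<dots> v = (\<lambda>(v1, v2, v3, v4, v5). v5 * (a * t + f - d) + q * a * v1) v" for v
    unfolding case_prod_unfold
    by (intro dird_eqI) (auto intro!: derivative_eq_intros simp: fun_eq_iff algebra_simps)
  finally show "zeta_ss X (t, s, u, p, q, r, m, w) = w * (a * t + f - 2 * d)"
    using x by (simp add: zeta_ss_def total_derivatives dird_components_quad_field algebra_simps)
qed

lemma smooth_on_field: "smooth_on \<Omega> X"
  using smooth_on_cong[OF \<Omega>(1), of X "quad_field a b c d e f g h"] X smooth_on_quad_field[OF \<Omega>(1)]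
  by blast

context
  assumes adm: "admissible n \<gamma> a b d f g h"
begin

text \<open>This is the coefficient of q^(1 - gamma) in the Noether identity. Its part linear in t
  vanishes by the condition on a; its constant part is the last admissibility relation with f
  restored.\<close>

lemma admissible_identity:
  "(\<gamma> - 1) * ((real n + 1) * (a * t + f) - d) = 2 * a * t + b + d"
proof -
  have "a * ((real n + 1) * \<gamma> - real n - 3) = 0" using adm by (auto simp: admissible_def)
  moreover have "b = 2 * f + d"
    "b * ((real n + 1) * \<gamma> - real n - 3) = d * ((real n + 3) * \<gamma> - real n - 1)"
    using adm by (auto simp: admissible_def)
  ultimately show ?thesis by algebra
qed

text \<open>For n >= 1 admissibility removes g and h, so eta is divisible by u; for n = 0 the factor
  \<open>real n\<close> annihilates both sides. Later computations therefore need no case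
  distinction.\<close>

lemma eta_over_u:
  assumes "(t, s, u) \<in> \<Omega>"
  shows "real n / u * eta X (t, s, u) = real n * (a * t + f)"
proof (cases "n = 0")
  case False
  then have "u > 0" "g = 0" "h = 0" using assms \<Omega>(2) adm by (auto simp: admissible_def)
  then show ?thesis by (simp add: components_quad_field[OF assms])
qed simp

text \<open>B1 is an antiderivative in u: the terms linear in p amount to p (a u + g), the total
  t-derivative of a u^2 / 2 + g u.\<close>

lemma noether_identity_quad_field:
  "noether_identity \<Omega> (gas_lagrangian n \<gamma> (\<lambda>_. A)) X
     (\<lambda>(t, s, u). a * u\<^sup>2 / 2 + g * u) (\<lambda>_. 0)"
  unfolding noether_identity_def
proof clarify
  fix t s u p q
  assume "(t, s, u, p, q) \<in> jets1 \<Omega>"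
  then have x: "(t, s, u) \<in> \<Omega>" and q: "q > 0" by auto
  then have u: "n \<ge> 1 \<longrightarrow> u > 0" using \<Omega>(2) by auto
  let ?L = "gas_lagrangian n \<gamma> (\<lambda>_. A)" and ?B = "\<lambda>(t, s, u). a * u\<^sup>2 / 2 + g * u"
  define W Q B where "W = phi_pow n \<gamma> u" and "Q = q powr (- \<gamma>)" and "B = A / (\<gamma> - 1)"
  have A: "A = B * (\<gamma> - 1)" using \<gamma> by (simp add: B_def)
  have B: "dird (v1, v2, v3) ?B (t, s, u) = (\<lambda>(v1, v2, v3). (a * u + g) * v3) (v1, v2, v3)" for v1 v2 v3
    unfolding case_prod_unfold
    by (intro dird_eqI) (auto intro!: derivative_eq_intros simp: fun_eq_iff algebra_simps)
  have 0: "dird v (\<lambda>_. 0 :: real) z = 0" for v and z :: jet0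
    by (rule dird_eqI) (rule has_derivative_const)
  have "lie_apply (prolong1 X) ?L (t, s, u, p, q) =
      p * (a * u + g + p * (f - b - a * t))
      + A * W * q * Q * (real n / u * eta X (t, s, u))
      + A * W * Q * (q * (a * t + f - d))"
    using x q u \<gamma>
    by (simp add: lie_apply_def dird_apply prolong1_def dird_gas_lagrangian zeta_quad_field
        powr_one_minus W_def Q_def)
  also have "\<dots> = p * (a * u + g) + p\<^sup>2 * (f - b - a * t)
      + B * W * q * Q * ((\<gamma> - 1) * ((real n + 1) * (a * t + f) - d))"
    unfolding eta_over_u[OF x] A by (simp add: algebra_simps power2_eq_square)
  \<comment> \<open>By b = 2 f + d, the kinetic coefficient f - b - a t equals -(2 a t + b + d) / 2.
    Kinetic and potential parts thus scale by the same weight, which cancels the divergence of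
    (xi^t, xi^s).\<close>
  also have "\<dots> = p * (a * u + g) - (p\<^sup>2 / 2 - B * W * q * Q) * (2 * a * t + b + d)"
  proof -
    have "b = 2 * f + d" using adm by (auto simp: admissible_def)
    then show ?thesis unfolding admissible_identity by (simp add: field_simps)
  qed
  finally show "lie_apply (prolong1 X) ?L (t, s, u, p, q)
      + ?L (t, s, u, p, q) * (Dt0 (xi_t X) (t, s, u, p, q) + Ds0 (xi_s X) (t, s, u, p, q))
      = Dt0 ?B (t, s, u, p, q) + Ds0 (\<lambda>_. 0) (t, s, u, p, q)"
    using q unfolding total_derivatives B 0
    by (simp add: dird_components_quad_field[OF x] gas_lagrangian_def powr_one_minus
        B_def W_def Q_def algebra_simps)
qed

lemma noether_symmetry_quad_field: "noether_symmetry \<Omega> (gas_lagrangian n \<gamma> (\<lambda>_. A)) X"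
proof -
  have "(\<lambda>(t, s, u). a * u\<^sup>2 / 2 + g * u) = (\<lambda>x :: jet0. 0 + fst x *\<^sub>R 0 + fst (snd x) *\<^sub>R 0
      + snd (snd x) *\<^sub>R g + (fst x * fst x) *\<^sub>R 0 + (fst x * snd (snd x)) *\<^sub>R 0
      + (snd (snd x) * snd (snd x)) *\<^sub>R (a / 2))"
    by (auto simp: fun_eq_iff power2_eq_square)
  then have "smooth_on \<Omega> (\<lambda>(t, s, u). a * u\<^sup>2 / 2 + g * u)"
    using smooth_on_quadratic[OF \<Omega>(1)] by (simp only:)
  moreover have "smooth_on \<Omega> (\<lambda>_. 0 :: real)"
    using smooth_on_quadratic[OF \<Omega>(1), of "0 :: real" 0 0 0 0 0 0] by simp
  ultimately show ?thesis
    unfolding noether_symmetry_def using smooth_on_field noether_identity_quad_field by blast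
qed

lemma variational_symmetry_quad_field:
  assumes "a = 0" "g = 0"
  shows "variational_symmetry \<Omega> (gas_lagrangian n \<gamma> (\<lambda>_. A)) X"
  using noether_identity_quad_field smooth_on_field
  by (simp add: variational_symmetry_def assms case_prod_unfold)

lemma point_symmetry_quad_field: "point_symmetry \<Omega> (gas_equation n \<gamma> (\<lambda>_. A)) X"
  unfolding point_symmetry_def
proof (intro conjI smooth_on_field ballI impI)
  let ?F = "gas_equation n \<gamma> (\<lambda>_. A)"
  fix z assume z: "z \<in> jets2 \<Omega>" and F: "?F z = 0"
  obtain t s u p q r m w where z_eq: "z = (t, s, u, p, q, r, m, w)" by (metis surj_pair)
  then have x: "(t, s, u) \<in> \<Omega>" and q: "q > 0" using z by auto
  then have u: "n \<ge> 1 \<longrightarrow> u > 0" using \<Omega>(2) by auto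
  define Z where "Z = \<gamma> * A * phi_pow n \<gamma> u * q powr (- \<gamma>)"
  define E where "E = a * t + f"
  \<comment> \<open>Eliminating phi_tt on the solution manifold turns every remaining term into a
    multiple of Z (n q / u + w / q).\<close>
  have r: "r = Z * (real n / u * q + w / q)"
    using F by (simp add: z_eq gas_equation_def Z_def algebra_simps)
  have NN: "real n / u / u * q * eta X (t, s, u) = real n / u * q * E"
  proof -
    have "real n / u / u * q * eta X (t, s, u) = (real n / u * eta X (t, s, u)) * (q / u)" by simp
    then show ?thesis unfolding eta_over_u[OF x] E_def by simp
  qed
  have "lie_apply (prolong2 X) ?F z = r * (f - 2 * b - 3 * a * t)
      - Z * ((1 - \<gamma>) * (real n / u * q + w / q) * (real n / u * eta X (t, s, u))
        - \<gamma> / q * (real n / u * q + w / q) * (q * (E - d))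
        - real n / u / u * q * eta X (t, s, u) + real n / u * (q * (E - d))
        + w * (E - 2 * d) / q - w / (q * q) * (q * (E - d)))"
    using x q u \<gamma>
    by (simp add: z_eq lie_apply_def dird_apply prolong2_def zeta_quad_field zeta2_quad_field
        dird_eqI[OF has_derivative_gas_equation] Z_def E_def)
  also have "\<dots> = r * (f - 2 * b - 3 * a * t)
      - Z * (real n / u * q + w / q) * ((1 - \<gamma>) * (real n * E) - \<gamma> * (E - d) - d)"
  proof -
    define K where "K = real n / u"
    show ?thesis
      unfolding NN eta_over_u[OF x, folded E_def] unfolding K_def[symmetric] using q by (simp add: field_simps)
  qed
  also have "\<dots> = Z * (real n / u * q + w / q) *
      (f - 2 * b - 3 * a * t - ((1 - \<gamma>) * (real n * E) - \<gamma> * (E - d) - d))"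
    unfolding r by (rule right_diff_distrib[symmetric])
  \<comment> \<open>Inserting \<open>admissible_identity\<close> collapses this factor to 2 f - b +
    d.\<close>
  also have "f - 2 * b - 3 * a * t - ((1 - \<gamma>) * (real n * E) - \<gamma> * (E - d) - d) = 0"
  proof -
    have "2 * f = b - d" using adm by (auto simp: admissible_def)
    then show ?thesis using admissible_identity[of t] unfolding E_def
      by (simp add: algebra_simps)
  qed
  finally show "lie_apply (prolong2 X) ?F z = 0" by simp
qed

end

end

subsection \<open>Determining equations\<close>

lemma cubic_eq_0:
  fixes a b c d :: real
  assumes "\<And>p. a + b * p + c * p\<^sup>2 + d * p ^ 3 = 0"
  shows "a = 0" "b = 0" "c = 0" "d = 0"
  using assms[of 0] assms[of 1] assms[of "-1"] assms[of 2] by simp_all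

text \<open>After multiplication by q^gamma, letting q tend to 0 from the right leaves only c2. Once
  c2 is gone, one factor q can be cancelled and the same limit isolates c3; an affine function then
  remains.\<close>

lemma powr_independent:
  fixes c0 c1 c2 c3 \<gamma> :: real
  assumes \<gamma>: "\<gamma> > 1"
    and eq: "\<And>q. q > 0 \<Longrightarrow> c0 + c1 * q + c2 * q powr (- \<gamma>) + c3 * q * q powr (- \<gamma>) = 0"
  shows "c0 = 0" "c1 = 0" "c2 = 0" "c3 = 0"
proof -
  have limit_0: "k0 = 0"
    if "\<delta> > 0" and "\<And>q. q > 0 \<Longrightarrow> (c0 + c1 * q) * q powr \<delta> + k0 + k1 * q = 0" for \<delta> k0 k1 :: real
  proof -
    have pos: "\<forall>\<^sub>F q in at_right (0::real). q > 0" by (rule eventually_at_right_less)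
    have "((\<lambda>q. (c0 + c1 * q) * q powr \<delta> + k0 + k1 * q) \<longlongrightarrow>
        (c0 + c1 * 0) * 0 powr \<delta> + k0 + k1 * 0) (at_right 0)"
      using that(1) eventually_mono[OF pos, of "\<lambda>q. 0 \<le> q"]
      by (intro tendsto_intros tendsto_powr') auto
    moreover have "((\<lambda>q. (c0 + c1 * q) * q powr \<delta> + k0 + k1 * q) \<longlongrightarrow> 0) (at_right 0)"
      by (rule tendsto_eventually) (use that(2) in \<open>auto intro: eventually_mono[OF pos]\<close>)
    ultimately show ?thesis
      using tendsto_unique[OF trivial_limit_at_right_real] that(1) by force
  qed
  have inv: "q powr \<gamma> * q powr (- \<gamma>) = 1" if "q > 0" for q :: real
    using that by (simp add: powr_minus)
  have mult: "(c0 + c1 * q) * q powr \<gamma> + c2 + c3 * q = 0" if "q > 0" for q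
  proof -
    have "0 = q powr \<gamma> * (c0 + c1 * q + c2 * q powr (- \<gamma>) + c3 * q * q powr (- \<gamma>))"
      using eq[OF that] by simp
    also have "\<dots> = (c0 + c1 * q) * q powr \<gamma> + (c2 + c3 * q) * (q powr \<gamma> * q powr (- \<gamma>))"
      by (simp add: algebra_simps)
    finally show ?thesis using inv[OF that] by simp
  qed
  show c2: "c2 = 0" using limit_0[OF _ mult] \<gamma> by auto
  \<comment> \<open>The exponent is still positive because gamma > 1, so \<open>limit_0\<close>
    applies again, now with k1 = 0.\<close>
  have "(c0 + c1 * q) * q powr (\<gamma> - 1) + c3 + 0 * q = 0" if "q > 0" for q
  proof -
    have "q * ((c0 + c1 * q) * q powr (\<gamma> - 1) + c3) = (c0 + c1 * q) * q powr \<gamma> + c2 + c3 * q"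
      using that powr_add[of q 1 "\<gamma> - 1"] c2 by (simp add: algebra_simps)
    then show ?thesis using mult[OF that] that by simp
  qed
  then show c3: "c3 = 0" using limit_0[of "\<gamma> - 1" c3 0] \<gamma> by auto
  show "c0 = 0" "c1 = 0" using eq[of 1] eq[of 2] c2 c3 by auto
qed

text \<open>At a fixed base point the partial derivatives are mere real numbers, so the splitting is
  pure algebra in p and q. Here k stands for A phi^(n (1 - gamma)) and N for n / u.\<close>

lemma determining_equations:
  fixes \<gamma> k N \<eta> :: real
  assumes \<gamma>: "\<gamma> > 1" and k: "k > 0"
    and eq: "\<And>p q. q > 0 \<Longrightarrow>
      p * (\<eta>t + p * \<eta>u - p * (\<xi>t + p * \<xi>u) - q * (\<sigma>t + p * \<sigma>u))
      + k * N * (q * q powr (- \<gamma>)) * \<eta>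
      + k * q powr (- \<gamma>) * (\<eta>s + q * \<eta>u - p * (\<xi>s + q * \<xi>u) - q * (\<sigma>s + q * \<sigma>u))
      + (p\<^sup>2 / 2 - k / (\<gamma> - 1) * (q * q powr (- \<gamma>))) * (\<xi>t + p * \<xi>u + (\<sigma>s + q * \<sigma>u))
      = B1t + p * B1u + (B2s + q * B2u)"
  shows "\<xi>s = 0" "\<xi>u = 0" "\<sigma>t = 0" "\<sigma>u = 0" "\<eta>s = 0" "2 * \<eta>u = \<xi>t - \<sigma>s"
    "\<eta>t = B1u" "B2u = 0" "B1t = - B2s" "(\<gamma> - 1) * (N * \<eta> + \<eta>u - \<sigma>s) = \<xi>t + \<sigma>s"
proof -
  define B where "B = k / (\<gamma> - 1)"
  have B: "k = B * (\<gamma> - 1)" "B \<noteq> 0" using \<gamma> k by (auto simp: B_def)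
  \<comment> \<open>C0, C1, C2 are the coefficients of 1, p, p^2; that of p^3 is - xi_u / 2.\<close>
  define C0 where "C0 q = - (B1t + B2s) + (- B2u) * q + k * \<eta>s * q powr (- \<gamma>)
      + (k * (N * \<eta> + \<eta>u - \<sigma>s - q * \<sigma>u) - B * (\<xi>t + \<sigma>s + q * \<sigma>u)) * q * q powr (- \<gamma>)" for q
  define C1 where "C1 q = (\<eta>t - B1u) + (- \<sigma>t) * q + (- k * \<xi>s) * q powr (- \<gamma>)
      + (- (k + B) * \<xi>u) * q * q powr (- \<gamma>)" for q
  define C2 where "C2 q = \<eta>u - \<xi>t - q * \<sigma>u + (\<xi>t + \<sigma>s + q * \<sigma>u) / 2" for q
  have cubic: "C0 q + C1 q * p + C2 q * p\<^sup>2 + (- \<xi>u / 2) * p ^ 3 = 0" if "q > 0" for p q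
    using eq[OF that, of p] unfolding B_def[symmetric] C0_def C1_def C2_def
    by (simp add: algebra_simps power2_eq_square power3_eq_cube add_divide_distrib diff_divide_distrib)
  have C: "C0 q = 0" "C1 q = 0" "C2 q = 0" "\<xi>u = 0" if "q > 0" for q
    using cubic_eq_0[OF cubic[OF that]] by auto
  show \<xi>u: "\<xi>u = 0" using C(4)[of 1] by simp
  \<comment> \<open>C2 is affine in q, so its values at q = 1 and q = 2 determine both of its
    coefficients.\<close>
  show \<sigma>u: "\<sigma>u = 0" and \<eta>u: "2 * \<eta>u = \<xi>t - \<sigma>s" using C(3)[of 1] C(3)[of 2] unfolding C2_def by (simp_all add: field_simps)
  note c1 = powr_independent[OF \<gamma> C(2)[unfolded C1_def]]
  show "\<eta>t = B1u" "\<sigma>t = 0" "\<xi>s = 0" using c1 k by auto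
  \<comment> \<open>In C0 the sigma_u terms carry q^2 q^(-gamma), which lies outside the four
    independent functions; they are removed before coefficients are compared.\<close>
  have "- (B1t + B2s) + (- B2u) * q + k * \<eta>s * q powr (- \<gamma>)
      + (k * (N * \<eta> + \<eta>u - \<sigma>s) - B * (\<xi>t + \<sigma>s)) * q * q powr (- \<gamma>) = 0" if "q > 0" for q
    using C(1)[OF that] unfolding C0_def \<sigma>u by simp
  note c0 = powr_independent[OF \<gamma> this]
  show "B1t = - B2s" "B2u = 0" "\<eta>s = 0" using c0 k by auto
  have "B * ((\<gamma> - 1) * (N * \<eta> + \<eta>u - \<sigma>s) - (\<xi>t + \<sigma>s)) = 0"
    using c0(4) unfolding B(1) by (simp add: algebra_simps)
  then show "(\<gamma> - 1) * (N * \<eta> + \<eta>u - \<sigma>s) = \<xi>t + \<sigma>s" using B by simp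
qed

section \<open>Integration of the determining equations\<close>

lemma constant_if_partials_zero:
  fixes f :: "jet0 \<Rightarrow> real"
  assumes D: "open D" "connected D"
    and f: "\<And>x. x \<in> D \<Longrightarrow> (f has_derivative F x) (at x)"
    and z: "\<And>x. x \<in> D \<Longrightarrow> F x (1,0,0) = 0 \<and> F x (0,1,0) = 0 \<and> F x (0,0,1) = 0"
  obtains c where "\<And>x. x \<in> D \<Longrightarrow> f x = c"
proof -
  have "(f has_derivative (\<lambda>v. 0)) (at x)" if "x \<in> D" for x
  proof -
    have "F x v = 0" for v
      using dird_Pair[of f x "fst v" "fst (snd v)" "snd (snd v)"] z[OF that] f[OF that]
      by (simp add: dird_eqI[OF f[OF that]] differentiableI)
    then have "F x = (\<lambda>v. 0)" by auto
    then show ?thesis using f[OF that] by simp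
  qed
  then show ?thesis using that has_derivative_zero_unique_connected[OF D] by metis
qed

lemma quad_field_if_determined:
  fixes \<xi> \<sigma> \<eta> B1 B2 :: "jet0 \<Rightarrow> real"
  assumes \<gamma>: "\<gamma> > 1" and \<Omega>: "open \<Omega>" "connected \<Omega>" "\<Omega> \<noteq> {}" "\<Omega> \<subseteq> base_domain n"
    and smooth: "smooth_on \<Omega> \<xi>" "smooth_on \<Omega> \<sigma>" "smooth_on \<Omega> \<eta>" "smooth_on \<Omega> B1" "smooth_on \<Omega> B2"
    and \<xi>: "\<And>x. x \<in> \<Omega> \<Longrightarrow> dird (0,1,0) \<xi> x = 0" "\<And>x. x \<in> \<Omega> \<Longrightarrow> dird (0,0,1) \<xi> x = 0"
    and \<sigma>: "\<And>x. x \<in> \<Omega> \<Longrightarrow> dird (1,0,0) \<sigma> x = 0" "\<And>x. x \<in> \<Omega> \<Longrightarrow> dird (0,0,1) \<sigma> x = 0"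
    and \<eta>s: "\<And>x. x \<in> \<Omega> \<Longrightarrow> dird (0,1,0) \<eta> x = 0"
    and \<eta>u: "\<And>x. x \<in> \<Omega> \<Longrightarrow> 2 * dird (0,0,1) \<eta> x = dird (1,0,0) \<xi> x - dird (0,1,0) \<sigma> x"
    and \<eta>t: "\<And>x. x \<in> \<Omega> \<Longrightarrow> dird (1,0,0) \<eta> x = dird (0,0,1) B1 x"
    and B2u: "\<And>x. x \<in> \<Omega> \<Longrightarrow> dird (0,0,1) B2 x = 0"
    and B1t: "\<And>x. x \<in> \<Omega> \<Longrightarrow> dird (1,0,0) B1 x = - dird (0,1,0) B2 x"
    and rel: "\<And>t s u. (t, s, u) \<in> \<Omega> \<Longrightarrow>
      (\<gamma> - 1) * (real n / u * \<eta> (t, s, u) + dird (0,0,1) \<eta> (t, s, u) - dird (0,1,0) \<sigma> (t, s, u))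
      = dird (1,0,0) \<xi> (t, s, u) + dird (0,1,0) \<sigma> (t, s, u)"
  obtains a b c d e f g h where "admissible n \<gamma> a b d f g h"
    "\<And>x. x \<in> \<Omega> \<Longrightarrow> (\<xi> x, \<sigma> x, \<eta> x) = quad_field a b c d e f g h x"
proof -
  note const = constant_if_partials_zero[OF \<Omega>(1,2)]
  note D = smooth_on_dird smooth smooth_on_has_derivative
  note comm = dird_commute[OF \<Omega>(1)]
  have zero: "dird v f x = 0" if "x \<in> \<Omega>" "\<And>y. y \<in> \<Omega> \<Longrightarrow> f y = 0" for v x and f :: "jet0 \<Rightarrow> real"
    using dird_cong[OF \<Omega>(1) that(1), of f "\<lambda>_. 0"] that(2) dird_eqI[OF has_derivative_const] by simp
  have \<eta>u': "2 * dird v (dird (0,0,1) \<eta>) x = dird v (dird (1,0,0) \<xi>) x - dird v (dird (0,1,0) \<sigma>) x"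
    if x: "x \<in> \<Omega>" for v x
  proof -
    have "dird v (\<lambda>x. 2 * dird (0,0,1) \<eta> x) x = dird v (\<lambda>x. dird (1,0,0) \<xi> x - dird (0,1,0) \<sigma> x) x"
      by (rule dird_cong[OF \<Omega>(1) x \<eta>u])
    moreover have "dird v (\<lambda>x. 2 * dird (0,0,1) \<eta> x) x = 2 * dird v (dird (0,0,1) \<eta>) x"
      by (rule dird_eqI) (auto intro!: derivative_eq_intros D x)
    moreover have "dird v (\<lambda>x. dird (1,0,0) \<xi> x - dird (0,1,0) \<sigma> x) x
        = dird v (dird (1,0,0) \<xi>) x - dird v (dird (0,1,0) \<sigma>) x"
      by (rule dird_eqI) (auto intro!: derivative_eq_intros D x)
    ultimately show ?thesis by simp
  qed
  have \<xi>ts: "dird (0,1,0) (dird (1,0,0) \<xi>) x = 0" "dird (0,0,1) (dird (1,0,0) \<xi>) x = 0" if "x \<in> \<Omega>" for x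
    by (simp_all add: comm[OF that smooth(1), where w = "(1,0,0)"] zero[OF that \<xi>(1)] zero[OF that \<xi>(2)])
  have \<sigma>st: "dird (1,0,0) (dird (0,1,0) \<sigma>) x = 0" "dird (0,0,1) (dird (0,1,0) \<sigma>) x = 0" if "x \<in> \<Omega>" for x
    by (simp_all add: comm[OF that smooth(2), where w = "(0,1,0)"] zero[OF that \<sigma>(1)] zero[OF that \<sigma>(2)])
  \<comment> \<open>Differentiating 2 eta_u = xi_t - sigma_s in s leaves only sigma_ss, because
    eta_s and xi_s vanish.\<close>
  have \<sigma>ss: "dird (0,1,0) (dird (0,1,0) \<sigma>) x = 0" if "x \<in> \<Omega>" for x
    using \<eta>u'[OF that, of "(0,1,0)"] \<xi>ts[OF that] zero[OF that \<eta>s]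
    by (simp add: comm[OF that smooth(3), where w = "(0,0,1)"])
  obtain d where d: "\<And>x. x \<in> \<Omega> \<Longrightarrow> dird (0,1,0) \<sigma> x = d"
    by (rule const[OF smooth_on_has_derivative[OF smooth_on_dird[OF smooth(2)]]])
       (use \<sigma>st \<sigma>ss in auto)
  obtain e where e: "\<And>x. x \<in> \<Omega> \<Longrightarrow> \<sigma> x - d * fst (snd x) = e"
  proof (rule const)
    show "((\<lambda>x. \<sigma> x - d * fst (snd x)) has_derivative (\<lambda>v. dird v \<sigma> x - d * fst (snd v))) (at x)"
      if "x \<in> \<Omega>" for x by (auto intro!: derivative_eq_intros D that)
  qed (use \<sigma> d in auto)
  \<comment> \<open>The boundary functions serve as a detour: eta_tt = B1_ut = B1_tu = - B2_su = -
    B2_us = 0.\<close>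
  have \<eta>tt: "dird (1,0,0) (dird (1,0,0) \<eta>) x = 0" if x: "x \<in> \<Omega>" for x
  proof -
    have "dird (1,0,0) (dird (1,0,0) \<eta>) x = dird (1,0,0) (dird (0,0,1) B1) x"
      by (rule dird_cong[OF \<Omega>(1) x \<eta>t])
    also have "\<dots> = dird (0,0,1) (dird (1,0,0) B1) x" by (rule comm[OF x smooth(4)])
    also have "\<dots> = dird (0,0,1) (\<lambda>x. - dird (0,1,0) B2 x) x" by (rule dird_cong[OF \<Omega>(1) x B1t])
    also have "\<dots> = - dird (0,0,1) (dird (0,1,0) B2) x"
      by (rule dird_eqI) (auto intro!: derivative_eq_intros D x)
    also have "\<dots> = - dird (0,1,0) (dird (0,0,1) B2) x" by (simp add: comm[OF x smooth(5)])
    also have "\<dots> = 0" using zero[OF x B2u] by simp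
    finally show ?thesis .
  qed
  have \<xi>tt: "dird (1,0,0) (dird (1,0,0) \<xi>) x = 2 * dird (0,0,1) (dird (1,0,0) \<eta>) x" if "x \<in> \<Omega>" for x
    using \<eta>u'[OF that, of "(1,0,0)"] \<sigma>st[OF that] comm[OF that smooth(3)] by simp
  have \<xi>ttt: "dird (1,0,0) (dird (1,0,0) (dird (1,0,0) \<xi>)) x = 0" if x: "x \<in> \<Omega>" for x
  proof -
    have "dird (1,0,0) (dird (1,0,0) (dird (1,0,0) \<xi>)) x
        = dird (1,0,0) (\<lambda>x. 2 * dird (0,0,1) (dird (1,0,0) \<eta>) x) x"
      by (rule dird_cong[OF \<Omega>(1) x \<xi>tt])
    also have "\<dots> = 2 * dird (1,0,0) (dird (0,0,1) (dird (1,0,0) \<eta>)) x"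
      by (rule dird_eqI) (auto intro!: derivative_eq_intros D x)
    also have "\<dots> = 2 * dird (0,0,1) (dird (1,0,0) (dird (1,0,0) \<eta>)) x"
      by (simp add: comm[OF x smooth_on_dird[OF smooth(3)]])
    also have "\<dots> = 0" using zero[OF x \<eta>tt] by simp
    finally show ?thesis .
  qed
  obtain a2 where a2: "\<And>x. x \<in> \<Omega> \<Longrightarrow> dird (1,0,0) (dird (1,0,0) \<xi>) x = a2"
  proof (rule const)
    show "(dird (1,0,0) (dird (1,0,0) \<xi>) has_derivative
        (\<lambda>v. dird v (dird (1,0,0) (dird (1,0,0) \<xi>)) x)) (at x)" if "x \<in> \<Omega>" for x
      by (rule smooth_on_has_derivative[OF smooth_on_dird[OF smooth_on_dird[OF smooth(1)]] that])
    show "dird (1,0,0) (dird (1,0,0) (dird (1,0,0) \<xi>)) x = 0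
        \<and> dird (0,1,0) (dird (1,0,0) (dird (1,0,0) \<xi>)) x = 0
        \<and> dird (0,0,1) (dird (1,0,0) (dird (1,0,0) \<xi>)) x = 0" if "x \<in> \<Omega>" for x
      using \<xi>ttt[OF that] zero[OF that \<xi>ts(1)] zero[OF that \<xi>ts(2)]
        comm[OF that smooth_on_dird[OF smooth(1)], of "(0,1,0)" "(1,0,0)" "(1,0,0)"]
        comm[OF that smooth_on_dird[OF smooth(1)], of "(0,0,1)" "(1,0,0)" "(1,0,0)"] by simp
  qed blast
  define a where "a = a2 / 2"
  obtain b where b: "\<And>x. x \<in> \<Omega> \<Longrightarrow> dird (1,0,0) \<xi> x - 2 * a * fst x = b"
  proof (rule const)
    show "((\<lambda>x. dird (1,0,0) \<xi> x - 2 * a * fst x) has_derivative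
        (\<lambda>v. dird v (dird (1,0,0) \<xi>) x - 2 * a * fst v)) (at x)"
      if "x \<in> \<Omega>" for x by (auto intro!: derivative_eq_intros D that)
  qed (use \<xi>ts a2 in \<open>auto simp: a_def\<close>)
  obtain c where c: "\<And>x. x \<in> \<Omega> \<Longrightarrow> \<xi> x - (a * (fst x * fst x) + b * fst x) = c"
  proof (rule const)
    show "((\<lambda>x. \<xi> x - (a * (fst x * fst x) + b * fst x)) has_derivative
        (\<lambda>v. dird v \<xi> x - (2 * a * fst x * fst v + b * fst v))) (at x)"
      if "x \<in> \<Omega>" for x by (auto intro!: derivative_eq_intros D that simp: fun_eq_iff algebra_simps)
    show "dird (1,0,0) \<xi> x - (2 * a * fst x * fst (1::real,0::real,0::real) + b * fst (1::real,0::real,0::real)) = 0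
      \<and> dird (0,1,0) \<xi> x - (2 * a * fst x * fst (0::real,1::real,0::real) + b * fst (0::real,1::real,0::real)) = 0
      \<and> dird (0,0,1) \<xi> x - (2 * a * fst x * fst (0::real,0::real,1::real) + b * fst (0::real,0::real,1::real)) = 0"
      if "x \<in> \<Omega>" for x using \<xi>[OF that] b[OF that] by simp
  qed blast
  define f where "f = (b - d) / 2"
  have \<xi>t: "dird (1,0,0) \<xi> x = 2 * a * fst x + b" if "x \<in> \<Omega>" for x
    using b[OF that] by simp
  have eta_u: "dird (0,0,1) \<eta> x = a * fst x + f" if "x \<in> \<Omega>" for x
    using \<eta>u[OF that] \<xi>t[OF that] d[OF that] by (simp add: f_def field_simps)
  \<comment> \<open>The relation contains eta itself, of which only eta_u is known so far. For n >=
    1 it is multiplied by u and differentiated in u; for n = 0 the eta term is absent.\<close>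
  have rel_u: "(\<gamma> - 1) * ((real n + 1) * (a * fst x + f) - d) - (2 * a * fst x + b + d) = 0"
    if x: "x \<in> \<Omega>" for x
  proof (cases "n = 0")
    case True
    obtain t s u where "x = (t, s, u)" by (metis surj_pair)
    then show ?thesis using rel[of t s u] x \<xi>t[OF x] eta_u[OF x] d[OF x] True by simp
  next
    case False
    define R where "R x = (\<gamma> - 1) * (real n * \<eta> x + snd (snd x) * (a * fst x + f - d))
      - snd (snd x) * (2 * a * fst x + b + d)" for x :: jet0
    have "R y = 0" if y: "y \<in> \<Omega>" for y
    proof -
      obtain t s u where y_eq: "y = (t, s, u)" by (metis surj_pair)
      then have u: "u > 0" using y \<Omega>(4) False by auto
      define K where "K = real n / u * \<eta> y"
      have "(\<gamma> - 1) * (K + (a * t + f) - d) = 2 * a * t + b + d"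
        using rel[of t s u] y \<xi>t[OF y] eta_u[OF y] d[OF y] y_eq by (simp add: K_def)
      moreover have "real n * \<eta> y = u * K" using u by (simp add: K_def)
      ultimately show ?thesis unfolding R_def by (simp add: y_eq) algebra
    qed
    then have "dird (0,0,1) R x = 0" by (rule zero[OF x])
    moreover have "dird v R x = (\<gamma> - 1) * (real n * dird v \<eta> x + snd (snd v) * (a * fst x + f - d)
        + snd (snd x) * a * fst v) - snd (snd v) * (2 * a * fst x + b + d)
        - snd (snd x) * 2 * a * fst v" for v
      unfolding R_def
      by (rule dird_eqI) (auto intro!: derivative_eq_intros D x simp: fun_eq_iff algebra_simps)
    ultimately show ?thesis using eta_u[OF x] by (simp add: algebra_simps)
  qed
  \<comment> \<open>\<Omega> may miss t = 0, so the coefficient of t is isolated by differentiation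
    rather than by evaluation.\<close>
  have rel_t: "(\<gamma> - 1) * (real n + 1) * a = 2 * a" and rel_0: "(\<gamma> - 1) * ((real n + 1) * f - d) = b + d"
  proof -
    obtain x where x: "x \<in> \<Omega>" using \<Omega>(3) by blast
    have "dird v (\<lambda>x :: jet0. (\<gamma> - 1) * ((real n + 1) * (a * fst x + f) - d) - (2 * a * fst x + b + d)) x
        = (\<gamma> - 1) * ((real n + 1) * (a * fst v)) - 2 * a * fst v" for v
      by (rule dird_eqI) (auto intro!: derivative_eq_intros simp: fun_eq_iff algebra_simps)
    from this[of "(1,0,0)"] show 1: "(\<gamma> - 1) * (real n + 1) * a = 2 * a"
      using zero[OF x rel_u] by simp
    show "(\<gamma> - 1) * ((real n + 1) * f - d) = b + d"
      using rel_u[OF x] arg_cong[OF 1, of "\<lambda>y. y * fst x"] by (simp add: algebra_simps)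
  qed
  have adm: "admissible n \<gamma> a b d f g h" if "n \<ge> 1 \<longrightarrow> g = 0 \<and> h = 0" for g h
  proof -
    have "a * ((real n + 1) * \<gamma> - (real n + 3)) = 0" using rel_t by (simp add: algebra_simps)
    then have "a \<noteq> 0 \<Longrightarrow> (real n + 1) * \<gamma> = real n + 3" by simp
    moreover have "b * ((real n + 1) * \<gamma> - real n - 3) = d * ((real n + 3) * \<gamma> - real n - 1)"
      using rel_0 by (simp add: f_def field_simps)
    ultimately show ?thesis using that by (auto simp: admissible_def f_def)
  qed
  \<comment> \<open>For n >= 1 comparison with \<open>rel_u\<close> gives eta algebraically, without
    integration constants. For n = 0 that relation says nothing about eta, and integrating eta_t and
    then eta produces g and h.\<close>
  have \<eta>: "\<exists>g h. (n \<ge> 1 \<longrightarrow> g = 0 \<and> h = 0)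
      \<and> (\<forall>x\<in>\<Omega>. \<eta> x = snd (snd x) * (a * fst x + f) + g * fst x + h)"
  proof (cases "n = 0")
    case False
    have "\<eta> x = snd (snd x) * (a * fst x + f)" if x: "x \<in> \<Omega>" for x
    proof -
      obtain t s u where x_eq: "x = (t, s, u)" by (metis surj_pair)
      then have u: "u > 0" using x \<Omega>(4) False by auto
      have "(\<gamma> - 1) * (real n / u * \<eta> x + (a * t + f) - d)
          = (\<gamma> - 1) * ((real n + 1) * (a * t + f) - d)"
        using rel[of t s u] x \<xi>t[OF x] eta_u[OF x] d[OF x] rel_u[OF x] x_eq by simp
      then have "real n / u * \<eta> x + (a * t + f) - d = (real n + 1) * (a * t + f) - d"
        using \<gamma> by (subst (asm) mult_cancel_left) auto
      then have "real n / u * \<eta> x = real n * (a * t + f)" by (simp add: distrib_right)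
      then have "real n * \<eta> x = real n * (u * (a * t + f))" using u by (simp add: field_simps)
      then show ?thesis using False by (subst (asm) mult_cancel_left) (simp add: x_eq)
    qed
    then show ?thesis by (intro exI[of _ 0]) simp
  next
    case True
    have \<eta>tu: "dird (0,0,1) (dird (1,0,0) \<eta>) x = a" if "x \<in> \<Omega>" for x
      using \<xi>tt[OF that] a2[OF that] by (simp add: a_def)
    obtain g where g: "\<And>x. x \<in> \<Omega> \<Longrightarrow> dird (1,0,0) \<eta> x - a * snd (snd x) = g"
    proof (rule const)
      show "((\<lambda>x. dird (1,0,0) \<eta> x - a * snd (snd x)) has_derivative
          (\<lambda>v. dird v (dird (1,0,0) \<eta>) x - a * snd (snd v))) (at x)"
        if "x \<in> \<Omega>" for x by (auto intro!: derivative_eq_intros D that)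
    qed (use \<eta>tt \<eta>tu comm[OF _ smooth(3)] zero[OF _ \<eta>s] in auto)
    obtain h where h: "\<And>x. x \<in> \<Omega> \<Longrightarrow> \<eta> x - (snd (snd x) * (a * fst x + f) + g * fst x) = h"
    proof (rule const)
      show "((\<lambda>x. \<eta> x - (snd (snd x) * (a * fst x + f) + g * fst x)) has_derivative
          (\<lambda>v. dird v \<eta> x - (snd (snd v) * (a * fst x + f) + snd (snd x) * a * fst v + g * fst v))) (at x)"
        if "x \<in> \<Omega>" for x by (auto intro!: derivative_eq_intros D that simp: fun_eq_iff algebra_simps)
    qed (use \<eta>s eta_u g in \<open>force simp: algebra_simps\<close>, blast)
    have "\<eta> x = snd (snd x) * (a * fst x + f) + g * fst x + h" if "x \<in> \<Omega>" for x
      using h[OF that] by simp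
    then show ?thesis using True by auto
  qed
  then obtain g h where gh: "n \<ge> 1 \<longrightarrow> g = 0 \<and> h = 0"
    "\<And>x. x \<in> \<Omega> \<Longrightarrow> \<eta> x = snd (snd x) * (a * fst x + f) + g * fst x + h" by blast
  show ?thesis
  proof (rule that[OF adm[OF gh(1)]])
    show "(\<xi> x, \<sigma> x, \<eta> x) = quad_field a b c d e f g h x" if "x \<in> \<Omega>" for x
      using c[OF that] e[OF that] gh(2)[OF that]
      by (auto simp: quad_field_def split_beta power2_eq_square)
  qed
qed

lemma noether_symmetry_imp_quad_field:
  assumes \<gamma>: "\<gamma> > 1" and A: "A > 0"
    and \<Omega>: "open \<Omega>" "connected \<Omega>" "\<Omega> \<noteq> {}" "\<Omega> \<subseteq> base_domain n"
    and X: "noether_symmetry \<Omega> (gas_lagrangian n \<gamma> (\<lambda>_. A)) X"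
  obtains a b c d e f g h where "admissible n \<gamma> a b d f g h"
    "\<And>x. x \<in> \<Omega> \<Longrightarrow> X x = quad_field a b c d e f g h x"
proof -
  let ?L = "gas_lagrangian n \<gamma> (\<lambda>_. A)"
  obtain B1 B2 where smooth: "smooth_on \<Omega> X" "smooth_on \<Omega> B1" "smooth_on \<Omega> B2"
    and id: "noether_identity \<Omega> ?L X B1 B2"
    using X by (auto simp: noether_symmetry_def)
  have smooth': "smooth_on \<Omega> (xi_t X)" "smooth_on \<Omega> (xi_s X)" "smooth_on \<Omega> (eta X)"
    unfolding xi_t_def xi_s_def eta_def
    by (rule smooth_on_bounded_linear[OF \<Omega>(1) _ smooth(1)],
        intro bounded_linear_intros bounded_linear_fst bounded_linear_snd)+
  note diff = differentiableI[OF smooth_on_has_derivative]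
  note eqs = determining_equations[OF \<gamma>, where
      k = "A * phi_pow n \<gamma> u" and N = "real n / u" and \<eta> = "eta X (t, s, u)"
      and \<xi>t = "dird (1,0,0) (xi_t X) (t, s, u)" and \<xi>s = "dird (0,1,0) (xi_t X) (t, s, u)"
      and \<xi>u = "dird (0,0,1) (xi_t X) (t, s, u)"
      and \<sigma>t = "dird (1,0,0) (xi_s X) (t, s, u)" and \<sigma>s = "dird (0,1,0) (xi_s X) (t, s, u)"
      and \<sigma>u = "dird (0,0,1) (xi_s X) (t, s, u)"
      and \<eta>t = "dird (1,0,0) (eta X) (t, s, u)" and \<eta>s = "dird (0,1,0) (eta X) (t, s, u)"
      and \<eta>u = "dird (0,0,1) (eta X) (t, s, u)"
      and B1t = "dird (1,0,0) B1 (t, s, u)" and B1u = "dird (0,0,1) B1 (t, s, u)"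
      and B2s = "dird (0,1,0) B2 (t, s, u)" and B2u = "dird (0,0,1) B2 (t, s, u)" for t s u]
  have k: "A * phi_pow n \<gamma> u > 0" if "(t, s, u) \<in> \<Omega>" for t s u
    using that \<Omega>(4) A by (intro mult_pos_pos phi_pow_pos) auto
  \<comment> \<open>The Noether identity with total derivatives expanded into partials, in the exact
    shape required by \<open>determining_equations\<close>.\<close>
  have E: "p * (dird (1,0,0) (eta X) x + p * dird (0,0,1) (eta X) x
        - p * (dird (1,0,0) (xi_t X) x + p * dird (0,0,1) (xi_t X) x)
        - q * (dird (1,0,0) (xi_s X) x + p * dird (0,0,1) (xi_s X) x))
      + A * phi_pow n \<gamma> u * (real n / u) * (q * q powr (- \<gamma>)) * eta X x
      + A * phi_pow n \<gamma> u * q powr (- \<gamma>) * (dird (0,1,0) (eta X) x + q * dird (0,0,1) (eta X) x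
        - p * (dird (0,1,0) (xi_t X) x + q * dird (0,0,1) (xi_t X) x)
        - q * (dird (0,1,0) (xi_s X) x + q * dird (0,0,1) (xi_s X) x))
      + (p\<^sup>2 / 2 - A * phi_pow n \<gamma> u / (\<gamma> - 1) * (q * q powr (- \<gamma>)))
        * (dird (1,0,0) (xi_t X) x + p * dird (0,0,1) (xi_t X) x
           + (dird (0,1,0) (xi_s X) x + q * dird (0,0,1) (xi_s X) x))
      = dird (1,0,0) B1 x + p * dird (0,0,1) B1 x + (dird (0,1,0) B2 x + q * dird (0,0,1) B2 x)"
    if x: "(t, s, u) \<in> \<Omega>" "x = (t, s, u)" and q: "q > 0" for t s u x p q
  proof -
    have u: "n \<ge> 1 \<longrightarrow> u > 0" using x \<Omega>(4) by auto
    have split: "dird (a, b, c) f x = a * dird (1,0,0) f x + b * dird (0,1,0) f x + c * dird (0,0,1) f x"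
      if "f \<in> {xi_t X, xi_s X, eta X, B1, B2}" for f a b c
      using that smooth smooth' x by (intro dird_Pair) (auto intro: diff)
    have "lie_apply (prolong1 X) ?L (t, s, u, p, q)
        + ?L (t, s, u, p, q) * (Dt0 (xi_t X) (t, s, u, p, q) + Ds0 (xi_s X) (t, s, u, p, q))
        = Dt0 B1 (t, s, u, p, q) + Ds0 B2 (t, s, u, p, q)"
      using id x q by (auto simp: noether_identity_def)
    moreover have "lie_apply (prolong1 X) ?L (t, s, u, p, q) =
        p * zeta_t X (t, s, u, p, q) + A * phi_pow n \<gamma> u * (real n / u) * (q * q powr (- \<gamma>)) * eta X x
        + A * phi_pow n \<gamma> u * q powr (- \<gamma>) * zeta_s X (t, s, u, p, q)"
      using q u \<gamma> x
      by (simp add: lie_apply_def dird_apply prolong1_def dird_gas_lagrangian powr_one_minus)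
    ultimately show ?thesis
      using split[of "xi_t X" 1 0 p] split[of "xi_t X" 0 1 q] split[of "xi_s X" 1 0 p]
        split[of "xi_s X" 0 1 q] split[of "eta X" 1 0 p] split[of "eta X" 0 1 q]
        split[of B1 1 0 p] split[of B2 0 1 q] q x
      by (simp add: zeta_t_def zeta_s_def Let_def total_derivatives gas_lagrangian_def powr_one_minus)
  qed
  have eqs': "dird (0,1,0) (xi_t X) x = 0" "dird (0,0,1) (xi_t X) x = 0"
    "dird (1,0,0) (xi_s X) x = 0" "dird (0,0,1) (xi_s X) x = 0" "dird (0,1,0) (eta X) x = 0"
    "2 * dird (0,0,1) (eta X) x = dird (1,0,0) (xi_t X) x - dird (0,1,0) (xi_s X) x"
    "dird (1,0,0) (eta X) x = dird (0,0,1) B1 x" "dird (0,0,1) B2 x = 0"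
    "dird (1,0,0) B1 x = - dird (0,1,0) B2 x" if "x \<in> \<Omega>" for x
  proof -
    obtain t s u where x: "x = (t, s, u)" by (metis surj_pair)
    show "dird (0,1,0) (xi_t X) x = 0" "dird (0,0,1) (xi_t X) x = 0"
      "dird (1,0,0) (xi_s X) x = 0" "dird (0,0,1) (xi_s X) x = 0" "dird (0,1,0) (eta X) x = 0"
      "2 * dird (0,0,1) (eta X) x = dird (1,0,0) (xi_t X) x - dird (0,1,0) (xi_s X) x"
      "dird (1,0,0) (eta X) x = dird (0,0,1) B1 x" "dird (0,0,1) B2 x = 0"
      "dird (1,0,0) B1 x = - dird (0,1,0) B2 x"
      unfolding x using eqs[OF k[OF that[unfolded x]] E[OF that[unfolded x] refl]] by blast+
  qed
  have rel: "(\<gamma> - 1) * (real n / u * eta X (t, s, u) + dird (0,0,1) (eta X) (t, s, u)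
      - dird (0,1,0) (xi_s X) (t, s, u)) = dird (1,0,0) (xi_t X) (t, s, u) + dird (0,1,0) (xi_s X) (t, s, u)"
    if "(t, s, u) \<in> \<Omega>" for t s u
    by (rule eqs(10)[OF k[OF that] E[OF that refl]])
  obtain a b c d e f g h where "admissible n \<gamma> a b d f g h"
    "\<And>x. x \<in> \<Omega> \<Longrightarrow> (xi_t X x, xi_s X x, eta X x) = quad_field a b c d e f g h x"
    by (rule quad_field_if_determined[OF \<gamma> \<Omega> smooth' smooth(2,3) eqs' rel]; blast)
  then show ?thesis using that by (auto simp: xi_t_def xi_s_def eta_def)
qed

subsection \<open>Linear spans and the classification\<close>

lemma in_span_on_empty: "in_span_on \<Omega> {} X \<longleftrightarrow> (\<forall>x\<in>\<Omega>. X x = 0)"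
  by (simp add: in_span_on_def)

text \<open>Generators are peeled off one at a time. Since Z may already lie in G, no two generators
  have to be shown distinct.\<close>

lemma in_span_on_insert:
  assumes "finite G"
  shows "in_span_on \<Omega> (insert Z G) X \<longleftrightarrow> (\<exists>k. in_span_on \<Omega> G (\<lambda>x. X x - k *\<^sub>R Z x))"
proof
  assume "in_span_on \<Omega> (insert Z G) X"
  then obtain c where c: "\<And>x. x \<in> \<Omega> \<Longrightarrow> X x = (\<Sum>Y\<in>insert Z G. c Y *\<^sub>R Y x)"
    unfolding in_span_on_def by blast
  have "X x - (if Z \<in> G then 0 else c Z) *\<^sub>R Z x = (\<Sum>Y\<in>G. c Y *\<^sub>R Y x)" if "x \<in> \<Omega>" for x
    using c[OF that] assms by (auto simp: insert_absorb)
  then show "\<exists>k. in_span_on \<Omega> G (\<lambda>x. X x - k *\<^sub>R Z x)" unfolding in_span_on_def by blast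
next
  assume "\<exists>k. in_span_on \<Omega> G (\<lambda>x. X x - k *\<^sub>R Z x)"
  then obtain k c where c: "\<And>x. x \<in> \<Omega> \<Longrightarrow> X x - k *\<^sub>R Z x = (\<Sum>Y\<in>G. c Y *\<^sub>R Y x)"
    unfolding in_span_on_def by blast
  \<comment> \<open>If Z is already in G, its coefficient there is increased by k; otherwise k
    becomes its coefficient.\<close>
  define c' where "c' = c(Z := (if Z \<in> G then c Z else 0) + k)"
  have "X x = (\<Sum>Y\<in>insert Z G. c' Y *\<^sub>R Y x)" if x: "x \<in> \<Omega>" for x
  proof -
    have "(\<Sum>Y\<in>insert Z G. c' Y *\<^sub>R Y x) = c' Z *\<^sub>R Z x + (\<Sum>Y\<in>G - {Z}. c' Y *\<^sub>R Y x)"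
      by (simp add: assms sum.insert_remove)
    also have "(\<Sum>Y\<in>G - {Z}. c' Y *\<^sub>R Y x) = (\<Sum>Y\<in>G - {Z}. c Y *\<^sub>R Y x)"
      by (rule sum.cong) (auto simp: c'_def)
    also have "c' Z *\<^sub>R Z x + \<dots> = k *\<^sub>R Z x + (\<Sum>Y\<in>G. c Y *\<^sub>R Y x)"
      by (cases "Z \<in> G") (simp_all add: c'_def sum.remove[OF assms] scaleR_add_left)
    also have "\<dots> = X x" by (simp add: c[OF x, symmetric])
    finally show ?thesis by simp
  qed
  then show "in_span_on \<Omega> (insert Z G) X" unfolding in_span_on_def by blast
qed

lemma finite_arbitrary_entropy_symmetries: "finite (arbitrary_entropy_symmetries n \<gamma>)"
  by (simp add: arbitrary_entropy_symmetries_def)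

text \<open>Both s-parameters are 0 because none of these fields moves s; the pair 2 ks, ks reflects
  the weights of \<open>V_scale\<close>.\<close>

lemma in_span_arbitrary_entropy:
  "in_span_on \<Omega> (arbitrary_entropy_symmetries n \<gamma>) X \<longleftrightarrow>
    (\<exists>kt h g ks a. (n \<ge> 1 \<longrightarrow> h = 0 \<and> g = 0) \<and> (\<gamma> \<noteq> gamma_star n \<longrightarrow> ks = 0 \<and> a = 0) \<and>
      (\<forall>x\<in>\<Omega>. X x = quad_field a (2 * ks) kt 0 0 ks g h x))"
proof -
  have comb: "quad_field a (2 * ks) kt 0 0 ks g h x = kt *\<^sub>R V_t x + (h *\<^sub>R V_phi x + (g *\<^sub>R V_tphi x
      + (ks *\<^sub>R V_scale x + a *\<^sub>R V_proj x)))" for a ks kt g h x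
    by (cases x) (simp add: quad_field_def V_t_def V_phi_def V_tphi_def V_scale_def V_proj_def
        algebra_simps)
  have G: "arbitrary_entropy_symmetries n \<gamma> =
      (if n = 0 then if \<gamma> = gamma_star n then {V_t, V_phi, V_tphi, V_scale, V_proj} else {V_t, V_phi, V_tphi}
       else if \<gamma> = gamma_star n then {V_t, V_scale, V_proj} else {V_t})"
    by (auto simp: arbitrary_entropy_symmetries_def)
  show ?thesis
    unfolding comb G
    by (cases "n = 0"; cases "\<gamma> = gamma_star n")
       (simp_all add: in_span_on_insert in_span_on_empty diff_diff_eq add.assoc)
qed

lemma gamma_star_iff: "\<gamma> = gamma_star n \<longleftrightarrow> (real n + 1) * \<gamma> - real n - 3 = 0"
  by (auto simp: gamma_star_def field_simps)

lemma scaling_coefficient_pos: "\<gamma> > 1 \<Longrightarrow> (real n + 3) * \<gamma> - real n - 1 > 0"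
proof -
  assume "\<gamma> > 1"
  then have "(real n + 3) * \<gamma> > (real n + 3) * 1" by (intro mult_strict_left_mono) auto
  then show ?thesis unfolding mult_1_right by linarith
qed

lemma Z2_quad_field: "Z2 x = quad_field 0 0 0 0 1 0 0 0 x"
  by (cases x) (simp add: Z2_def quad_field_def)

lemma Z3_quad_field:
  "Z3 n \<gamma> x = quad_field 0 ((real n + 3) * \<gamma> - real n - 1) 0 ((real n + 1) * \<gamma> - real n - 3) 0
     (\<gamma> + 1) 0 0 x"
  by (cases x) (simp add: Z3_def quad_field_def)

text \<open>The relation b N = d M defines a line of pairs (b, d) in either case, as M > 0. For N
  \<noteq> 0 it is spanned by the weights of Z3; for N = 0 it is d = 0, which is the line of
  \<open>V_scale\<close>.\<close>

lemma in_span_iff_quad_field: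
  assumes \<gamma>: "\<gamma> > 1"
  shows "in_span_on \<Omega> ({Z2, Z3 n \<gamma>} \<union> arbitrary_entropy_symmetries n \<gamma>) X \<longleftrightarrow>
    (\<exists>a b c d e f g h. admissible n \<gamma> a b d f g h \<and> (\<forall>x\<in>\<Omega>. X x = quad_field a b c d e f g h x))"
    (is "?L \<longleftrightarrow> ?R")
proof -
  define M N where "M = (real n + 3) * \<gamma> - real n - 1" and "N = (real n + 1) * \<gamma> - real n - 3"
  have MN: "M - N = 2 * (\<gamma> + 1)" by (simp add: M_def N_def algebra_simps)
  have N: "\<gamma> = gamma_star n \<longleftrightarrow> N = 0" by (simp add: gamma_star_iff N_def)
  have M: "M > 0" using scaling_coefficient_pos[OF \<gamma>] by (simp add: M_def)
  have adm: "admissible n \<gamma> a b d f g h \<longleftrightarrow> 2 * f = b - d \<and> (n \<ge> 1 \<longrightarrow> g = 0 \<and> h = 0)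
      \<and> (a \<noteq> 0 \<longrightarrow> N = 0) \<and> b * N = d * M" for a b d f g h
    by (auto simp: admissible_def N_def M_def)
  have sum: "X x - k2 *\<^sub>R Z2 x - k3 *\<^sub>R Z3 n \<gamma> x = quad_field a (2 * ks) kt 0 0 ks g h x \<longleftrightarrow>
      X x = quad_field a (k3 * M + 2 * ks) kt (k3 * N) k2 (k3 * (\<gamma> + 1) + ks) g h x"
    for k2 k3 a ks kt g h x
  proof -
    have "quad_field a (k3 * M + 2 * ks) kt (k3 * N) k2 (k3 * (\<gamma> + 1) + ks) g h x
        = quad_field a (2 * ks) kt 0 0 ks g h x + k3 *\<^sub>R Z3 n \<gamma> x + k2 *\<^sub>R Z2 x"
      unfolding Z2_quad_field Z3_quad_field M_def[symmetric] N_def[symmetric]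
      by (cases x) (simp add: quad_field_def algebra_simps)
    then show ?thesis by (simp only: diff_eq_eq)
  qed
  have "?L \<longleftrightarrow> (\<exists>k2 k3 kt h g ks a. (n \<ge> 1 \<longrightarrow> h = 0 \<and> g = 0) \<and> (N \<noteq> 0 \<longrightarrow> ks = 0 \<and> a = 0) \<and>
      (\<forall>x\<in>\<Omega>. X x = quad_field a (k3 * M + 2 * ks) kt (k3 * N) k2 (k3 * (\<gamma> + 1) + ks) g h x))"
    by (simp add: in_span_on_insert finite_arbitrary_entropy_symmetries in_span_arbitrary_entropy
        sum N)
  also have "\<dots> \<longleftrightarrow> ?R"
  proof
    assume "\<exists>k2 k3 kt h g ks a. (n \<ge> 1 \<longrightarrow> h = 0 \<and> g = 0) \<and> (N \<noteq> 0 \<longrightarrow> ks = 0 \<and> a = 0) \<and>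
      (\<forall>x\<in>\<Omega>. X x = quad_field a (k3 * M + 2 * ks) kt (k3 * N) k2 (k3 * (\<gamma> + 1) + ks) g h x)"
    then obtain k2 k3 kt h g ks a where k: "n \<ge> 1 \<longrightarrow> h = 0 \<and> g = 0" "N \<noteq> 0 \<longrightarrow> ks = 0 \<and> a = 0"
      "\<forall>x\<in>\<Omega>. X x = quad_field a (k3 * M + 2 * ks) kt (k3 * N) k2 (k3 * (\<gamma> + 1) + ks) g h x"
      by blast
    have "2 * (k3 * (\<gamma> + 1) + ks) = (k3 * M + 2 * ks) - k3 * N"
      using arg_cong[OF MN, of "\<lambda>y. k3 * y"] by (simp add: algebra_simps)
    moreover have "(k3 * M + 2 * ks) * N = k3 * N * M" using k(2) by (cases "N = 0") auto
    ultimately have "admissible n \<gamma> a (k3 * M + 2 * ks) (k3 * N) (k3 * (\<gamma> + 1) + ks) g h"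
      using k(1,2) unfolding adm by blast
    then show ?R using k(3) by blast
  next
    assume ?R
    then obtain a b c d e f g h where abc: "admissible n \<gamma> a b d f g h"
      "\<forall>x\<in>\<Omega>. X x = quad_field a b c d e f g h x" by blast
    obtain k3 ks where "b = k3 * M + 2 * ks" "d = k3 * N" "f = k3 * (\<gamma> + 1) + ks" "N \<noteq> 0 \<longrightarrow> ks = 0"
    proof (cases "N = 0")
      case True
      \<comment> \<open>Z3 is a multiple of \<open>V_scale\<close> here, so k3 = 0 may be chosen and
        the whole scaling part is assigned to ks.\<close>
      then have "d = 0" "f = b / 2" using abc(1) M unfolding adm by auto
      then show ?thesis using that[of 0 "b / 2"] True by simp
    next
      case False
      define k3 where "k3 = d / N"
      have d: "d = k3 * N" using False by (simp add: k3_def)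
      have "b * N = k3 * M * N" using abc(1) d unfolding adm by simp
      then have b: "b = k3 * M" using False by simp
      have "2 * f = k3 * (M - N)" using abc(1) b d unfolding adm by (simp add: right_diff_distrib)
      then have "f = k3 * (\<gamma> + 1)" unfolding MN mult.left_commute[of k3] by linarith
      then show ?thesis using that[of k3 0] b d by simp
    qed
    moreover have "n \<ge> 1 \<longrightarrow> h = 0 \<and> g = 0" "N \<noteq> 0 \<longrightarrow> a = 0" using abc(1) unfolding adm by auto
    ultimately show "\<exists>k2 k3 kt h g ks a. (n \<ge> 1 \<longrightarrow> h = 0 \<and> g = 0) \<and> (N \<noteq> 0 \<longrightarrow> ks = 0 \<and> a = 0) \<and>
      (\<forall>x\<in>\<Omega>. X x = quad_field a (k3 * M + 2 * ks) kt (k3 * N) k2 (k3 * (\<gamma> + 1) + ks) g h x)"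
      using abc(2) by blast
  qed
  finally show ?thesis .
qed

theorem mainTheorem4:
  fixes n :: nat and \<gamma> A0 :: real and S :: "real \<Rightarrow> real" and \<Omega> :: "jet0 set"
    and L :: "jet1 \<Rightarrow> real" and F :: "jet2 \<Rightarrow> real" and G :: "pvf set"
  assumes n: "n \<in> {0, 1, 2}"
    and gamma: "\<gamma> > 1"
    and A0: "A0 > 0"
    and S: "\<And>s. S s = A0"
    and L: "L = gas_lagrangian n \<gamma> S"
    and F: "F = gas_equation n \<gamma> S"
    and G: "G = arbitrary_entropy_symmetries n \<gamma>"
    and dom: "open \<Omega>" "connected \<Omega>" "\<Omega> \<noteq> {}" "\<Omega> \<subseteq> base_domain n"
  shows "(\<forall>z\<in>jets2 \<Omega>. euler_lagrange L z = 0 \<longleftrightarrow> F z = 0)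
    \<and> variational_symmetry \<Omega> L Z2
    \<and> variational_symmetry \<Omega> L (Z3 n \<gamma>)
    \<and> (\<forall>z\<in>jets1 \<Omega>. noether_density_t L Z2 z = T2_t z \<and> noether_density_s L Z2 z = T2_s n \<gamma> S z)
    \<and> conservation_law \<Omega> F T2_t (T2_s n \<gamma> S)
    \<and> (\<forall>z\<in>jets1 \<Omega>. noether_density_t L (Z3 n \<gamma>) z = T3_t n \<gamma> S z
          \<and> noether_density_s L (Z3 n \<gamma>) z = T3_s n \<gamma> S z)
    \<and> conservation_law \<Omega> F (T3_t n \<gamma> S) (T3_s n \<gamma> S)
    \<and> {X. point_symmetry \<Omega> F X \<and> noether_symmetry \<Omega> L X}
        = {X. in_span_on \<Omega> ({Z2, Z3 n \<gamma>} \<union> G) X}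
    \<and> \<not> in_span_on \<Omega> G Z2
    \<and> (\<gamma> \<noteq> gamma_star n \<longrightarrow> \<not> in_span_on \<Omega> ({Z2} \<union> G) (Z3 n \<gamma>))
    \<and> (\<gamma> = gamma_star n \<longrightarrow>
          (\<exists>k. k \<noteq> 0 \<and> (\<forall>x. Z3 n \<gamma> x = k *\<^sub>R V_scale x)) \<and> in_span_on \<Omega> G (Z3 n \<gamma>))"
proof -
  have "S = (\<lambda>_. A0)" using S by auto
  note [simp] = L F G this
  let ?M = "(real n + 3) * \<gamma> - real n - 1" and ?N = "(real n + 1) * \<gamma> - real n - 3"
  have pos: "q > 0 \<and> (n \<ge> 1 \<longrightarrow> u > 0)" if "(t, s, u) \<in> \<Omega>" "q > 0" for t s u q
    using that dom(4) by auto
  have pos1: "q > 0 \<and> (n \<ge> 1 \<longrightarrow> u > 0)" if "(t, s, u, p, q) \<in> jets1 \<Omega>" for t s u p q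
    using that pos by auto
  have pos2: "q > 0 \<and> (n \<ge> 1 \<longrightarrow> u > 0)" if "(t, s, u, p, q, r, m, w) \<in> jets2 \<Omega>" for t s u p q r m w
    using that pos by auto
  have "\<forall>z\<in>jets2 \<Omega>. euler_lagrange L z = 0 \<longleftrightarrow> F z = 0"
    using euler_lagrange_gas[OF gamma] pos2 by (auto simp del: mem_jets2)
  \<comment> \<open>Both new fields have a = g = 0, so B1 = a u^2 / 2 + g u vanishes for
    them.\<close>
  moreover have "variational_symmetry \<Omega> L Z2"
    using variational_symmetry_quad_field[OF gamma dom(1,4) Z2_quad_field]
    by (simp add: admissible_def)
  moreover have "variational_symmetry \<Omega> L (Z3 n \<gamma>)"
    using variational_symmetry_quad_field[OF gamma dom(1,4) Z3_quad_field]
    by (simp add: admissible_def algebra_simps)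
  moreover have "\<forall>z\<in>jets1 \<Omega>. noether_density_t L Z2 z = T2_t z \<and> noether_density_s L Z2 z = T2_s n \<gamma> S z"
    using noether_density_Z2[OF gamma] pos1 by (auto simp del: mem_jets1)
  moreover have "conservation_law \<Omega> F T2_t (T2_s n \<gamma> S)"
    using divergence_T2[OF gamma] pos2 by (auto simp: conservation_law_def simp del: mem_jets2)
  moreover have "\<forall>z\<in>jets1 \<Omega>. noether_density_t L (Z3 n \<gamma>) z = T3_t n \<gamma> S z
      \<and> noether_density_s L (Z3 n \<gamma>) z = T3_s n \<gamma> S z"
    using noether_density_Z3[OF gamma] pos1 by (auto simp del: mem_jets1)
  moreover have "conservation_law \<Omega> F (T3_t n \<gamma> S) (T3_s n \<gamma> S)"
    using divergence_T3[OF gamma] pos2 by (auto simp: conservation_law_def simp del: mem_jets2)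
  moreover have "{X. point_symmetry \<Omega> F X \<and> noether_symmetry \<Omega> L X}
      = {X. in_span_on \<Omega> ({Z2, Z3 n \<gamma>} \<union> G) X}"
  proof -
    have "point_symmetry \<Omega> F X \<and> noether_symmetry \<Omega> L X \<longleftrightarrow>
      (\<exists>a b c d e f g h. admissible n \<gamma> a b d f g h \<and> (\<forall>x\<in>\<Omega>. X x = quad_field a b c d e f g h x))" for X
    proof
      assume "point_symmetry \<Omega> F X \<and> noether_symmetry \<Omega> L X"
      then have "noether_symmetry \<Omega> (gas_lagrangian n \<gamma> (\<lambda>_. A0)) X" by simp
      from noether_symmetry_imp_quad_field[OF gamma A0 dom this]
      show "\<exists>a b c d e f g h. admissible n \<gamma> a b d f g h
        \<and> (\<forall>x\<in>\<Omega>. X x = quad_field a b c d e f g h x)" by metis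
    next
      assume "\<exists>a b c d e f g h. admissible n \<gamma> a b d f g h
        \<and> (\<forall>x\<in>\<Omega>. X x = quad_field a b c d e f g h x)"
      then obtain a b c d e f g h where adm: "admissible n \<gamma> a b d f g h"
        and X: "\<And>x. x \<in> \<Omega> \<Longrightarrow> X x = quad_field a b c d e f g h x" by blast
      show "point_symmetry \<Omega> F X \<and> noether_symmetry \<Omega> L X"
        using point_symmetry_quad_field[OF gamma dom(1,4) X adm]
          noether_symmetry_quad_field[OF gamma dom(1,4) X adm] by simp
    qed
    then show ?thesis using in_span_iff_quad_field[OF gamma] by simp
  qed
  moreover have "\<not> in_span_on \<Omega> G Z2"
  proof -
    \<comment> \<open>One point suffices: the s-component of Z2 is 1, whereas every combination of
      the fields in G has s-component 0.\<close>
    obtain t s u where "(t, s, u) \<in> \<Omega>" using dom(3) by auto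
    then show ?thesis
      by (auto simp: in_span_arbitrary_entropy quad_field_def Z2_def dest!: bspec[of \<Omega> _ "(t, s, u)"])
  qed
  moreover have "\<not> in_span_on \<Omega> ({Z2} \<union> G) (Z3 n \<gamma>)" if "\<gamma> \<noteq> gamma_star n"
  proof
    assume "in_span_on \<Omega> ({Z2} \<union> G) (Z3 n \<gamma>)"
    then obtain k where "in_span_on \<Omega> (arbitrary_entropy_symmetries n \<gamma>) (\<lambda>x. Z3 n \<gamma> x - k *\<^sub>R Z2 x)"
      by (auto simp: in_span_on_insert finite_arbitrary_entropy_symmetries)
    then obtain kt g h ks a where "\<gamma> \<noteq> gamma_star n \<longrightarrow> ks = 0 \<and> a = 0"
      "\<forall>x\<in>\<Omega>. Z3 n \<gamma> x - k *\<^sub>R Z2 x = quad_field a (2 * ks) kt 0 0 ks g h x"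
      unfolding in_span_arbitrary_entropy by blast
    then have k: "\<And>x. x \<in> \<Omega> \<Longrightarrow> Z3 n \<gamma> x - k *\<^sub>R Z2 x = quad_field 0 0 kt 0 0 0 g h x"
      using that by simp
    have Z3: "Z3 n \<gamma> x = quad_field 0 0 kt 0 k 0 g h x" if "x \<in> \<Omega>" for x
      using k[OF that] by (cases x) (simp add: quad_field_def Z2_def Z3_def)
    obtain t s u where x: "(t, s, u) \<in> \<Omega>" using dom(3) by auto
    \<comment> \<open>At a single point the t-component M t could agree with the constant kt; its
      t-derivative is M > 0 on one side and 0 on the other.\<close>
    have "?M = dird (1, 0, 0) (xi_t (Z3 n \<gamma>)) (t, s, u)"
      by (simp add: dird_components_quad_field(1)[OF gamma dom(1,4) Z3_quad_field x])
    also have "\<dots> = 0" by (simp add: dird_components_quad_field(1)[OF gamma dom(1,4) Z3 x])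
    finally show False using scaling_coefficient_pos[OF gamma, of n] by simp
  qed
  moreover have "(\<exists>k. k \<noteq> 0 \<and> (\<forall>x. Z3 n \<gamma> x = k *\<^sub>R V_scale x)) \<and> in_span_on \<Omega> G (Z3 n \<gamma>)"
    if "\<gamma> = gamma_star n"
  proof -
    have N: "?N = 0" using that gamma_star_iff by blast
    then have M: "?M = 2 * (\<gamma> + 1)" by (simp add: algebra_simps)
    have "Z3 n \<gamma> x = (\<gamma> + 1) *\<^sub>R V_scale x" for x
      by (cases x) (simp add: Z3_def V_scale_def N M)
    moreover have "\<gamma> + 1 \<noteq> 0" using gamma by simp
    moreover have "Z3 n \<gamma> x = quad_field 0 (2 * (\<gamma> + 1)) 0 0 0 (\<gamma> + 1) 0 0 x" for x
      using Z3_quad_field[of n \<gamma> x] unfolding N M .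
    then have "in_span_on \<Omega> (arbitrary_entropy_symmetries n \<gamma>) (Z3 n \<gamma>)"
      unfolding in_span_arbitrary_entropy using that
      by (intro exI[of _ 0] exI[of _ "\<gamma> + 1"]) blast
    ultimately show ?thesis by auto
  qed
  ultimately show ?thesis by blast
qed

end
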